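(* Let $n\ge 1$ and $\hbar>0$. There is a bijective correspondence $$\mathcal{G}:\mathcal{CS}(n,\mathbb{R})\longrightarrow\mathcal{QB}(2n,\mathbb{R})$$ between the set of squeezed coherent states (identified up to a constant phase factor) and the set of quantum blobs, defined as follows: for $M=X+iY$ (with $X,Y$ real symmetric $n\times n$ matrices, $X$ positive definite) and $z_0\in\mathbb{R}^{2n}$, if the Wigner transform of $\Phi^\hbar_{M,z_0}$ is written $$W\Phi^\hbar_{M,z_0}(z)=(\pi\hbar)^{-n}e^{-\frac1\hbar G(z-z_0)\cdot(z-z_0)}$$ with $G$ a real symmetric positive definite $2n\times 2n$ matrix, then $$\mathcal{G}[\Phi^\hbar_{M,z_0}]=\{z\in\mathbb{R}^{2n}: G(z-z_0)\cdot(z-z_0)\le\hbar\}=\mathcal{QB}^{2n}(z_0,S^{-1}),$$ where $$S=\begin{pmatrix} X^{1/2} & 0 \\ X^{-1/2}Y & X^{-1/2} \end{pmatrix}\in\operatorname{Sp}(2n,\mathbb{R}).$$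
   Context: Phase space is $\mathbb{R}^{2n}$ with points $z=(x,p)$, $x,p\in\mathbb{R}^n$; the dot denotes the Euclidean scalar product. $J=\begin{pmatrix} 0 & I \\ -I & 0 \end{pmatrix}$ and $\operatorname{Sp}(2n,\mathbb{R})=\{S: S^TJS=J\}$. Squeezed coherent states: for $M=X+iY$ with $X,Y$ real symmetric $n\times n$ matrices, $X$ positive definite, $$\Phi^\hbar_M(x)=(\pi\hbar)^{-n/4}(\det X)^{1/4}e^{-\frac{1}{2\hbar}(X+iY)x\cdot x},$$ and for $z_0=(x_0,p_0)$, $\Phi^\hbar_{M,z_0}=\widehat T^\hbar(z_0)\Phi^\hbar_M$, where $\widehat T^\hbar(z_0)\Psi(x)=e^{\frac{i}{\hbar}(p_0\cdot x-\frac12 p_0\cdot x_0)}\Psi(x-x_0)$. The set $\mathcal{CS}(n,\mathbb{R})$ consists of all functions $e^{\frac{i}{\hbar}\gamma}\Phi^\hbar_{M,z_0}$, $\gamma\in\mathbb{R}$, where two functions differing only by a constant factor $e^{\frac i\hbar\gamma}$ are identified. Wigner transform: $W\Psi(z)=\left(\tfrac{1}{2\pi\hbar}\right)^n\int_{\mathbb{R}^n}e^{-\frac i\hbar p\cdot y}\Psi(x+\tfrac12y)\Psi^*(x-\tfrac12y)\,d^ny$, where $^*$ is complex conjugation. For $\Psi=\Phi^\hbar_{M,z_0}$ it has the Gaussian form displayed in the claim with $G=\begin{pmatrix} X+YX^{-1}Y & YX^{-1} \\ X^{-1}Y & X^{-1} \end{pmatrix}=S^TS$. Quantum blobs: for $S\in\operatorname{Sp}(2n,\mathbb{R})$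 and $z_0\in\mathbb{R}^{2n}$, $\mathcal{QB}^{2n}(z_0,S)=z_0+S\,B^{2n}(\sqrt\hbar)=\{z:(S^{-1})^TS^{-1}(z-z_0)\cdot(z-z_0)\le\hbar\}$, where $B^{2n}(\sqrt\hbar)=\{z:|z|\le\sqrt\hbar\}$. $\mathcal{QB}(2n,\mathbb{R})$ is the set of all quantum blobs, as subsets of $\mathbb{R}^{2n}$. *)

theory Defs
  imports "HOL-Analysis.Analysis"
begin

(* A point z = (x, p) of R^2n is a vector indexed by the disjoint sum 'n + 'n, so that the norm,
   inner product and matrix operations on phase space are the library ones. *)
type_synonym 'n phase = "real ^ ('n + 'n)"
type_synonym 'n phase_mat = "real ^ ('n + 'n) ^ ('n + 'n)"

definition pos_part :: "'n::finite phase \<Rightarrow> real ^ 'n" where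
  "pos_part z = (\<chi> i. z $ Inl i)"

definition mom_part :: "'n::finite phase \<Rightarrow> real ^ 'n" where
  "mom_part z = (\<chi> i. z $ Inr i)"

definition block_matrix ::
    "real^'n^'n \<Rightarrow> real^'n^'n \<Rightarrow> real^'n^'n \<Rightarrow> real^'n^'n \<Rightarrow> 'n::finite phase_mat" where
  "block_matrix A B C D = (\<chi> i j.
     case i of
       Inl k \<Rightarrow> (case j of Inl l \<Rightarrow> A $ k $ l | Inr l \<Rightarrow> B $ k $ l)
     | Inr k \<Rightarrow> (case j of Inl l \<Rightarrow> C $ k $ l | Inr l \<Rightarrow> D $ k $ l))"

definition sympl_J :: "'n::finite phase_mat" where
  "sympl_J = block_matrix 0 (mat 1) (- mat 1) 0"

definition Sp :: "'n::finite phase_mat set" where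
  "Sp = {S. transpose S ** sympl_J ** S = sympl_J}"

definition sym_matrix :: "real^'m^'m \<Rightarrow> bool" where
  "sym_matrix A \<longleftrightarrow> transpose A = A"

definition sym_pos_def :: "real^'m^'m \<Rightarrow> bool" where
  "sym_pos_def A \<longleftrightarrow> sym_matrix A \<and> (\<forall>x. x \<noteq> 0 \<longrightarrow> (A *v x) \<bullet> x > 0)"

(* X^(1/2); meaningful for symmetric positive definite X, where exactly one such R exists. *)
definition matrix_sqrt :: "real^'m^'m \<Rightarrow> real^'m^'m" where
  "matrix_sqrt X = (THE R. sym_pos_def R \<and> R ** R = X)"

(* The Gaussian for M = X + iY. As x is real, (X + iY)x . x = Xx . x + i (Yx . x). *)
definition Phi :: "real \<Rightarrow> real^'n^'n \<Rightarrow> real^'n^'n \<Rightarrow> real^'n \<Rightarrow> complex" where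
  "Phi hbar X Y x =
     of_real ((pi * hbar) powr (- real CARD('n) / 4) * det X powr (1/4)) *
     exp (- of_real (1 / (2 * hbar)) *
          (of_real ((X *v x) \<bullet> x) + \<i> * of_real ((Y *v x) \<bullet> x)))"

definition heisenberg_weyl ::
    "real \<Rightarrow> 'n::finite phase \<Rightarrow> (real^'n \<Rightarrow> complex) \<Rightarrow> real^'n \<Rightarrow> complex" where
  "heisenberg_weyl hbar z0 \<Psi> x =
     exp (\<i> / of_real hbar *
          of_real (mom_part z0 \<bullet> x - (1/2) * (mom_part z0 \<bullet> pos_part z0))) *
     \<Psi> (x - pos_part z0)"

definition Phi_at ::
    "real \<Rightarrow> real^'n^'n \<Rightarrow> real^'n^'n \<Rightarrow> 'n::finite phase \<Rightarrow> real^'n \<Rightarrow> complex" where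
  "Phi_at hbar X Y z0 = heisenberg_weyl hbar z0 (Phi hbar X Y)"

definition squeezed_states :: "real \<Rightarrow> (real^'n::finite \<Rightarrow> complex) set" where
  "squeezed_states hbar =
     {\<lambda>x. exp (\<i> / of_real hbar * of_real \<gamma>) * Phi_at hbar X Y z0 x | \<gamma> X Y z0.
        sym_pos_def X \<and> sym_matrix Y}"

definition phase_rel :: "real \<Rightarrow> ((real^'n::finite \<Rightarrow> complex) \<times> (real^'n \<Rightarrow> complex)) set" where
  "phase_rel hbar =
     {(\<Psi>, \<Psi>'). \<exists>\<gamma>::real. \<Psi>' = (\<lambda>x. exp (\<i> / of_real hbar * of_real \<gamma>) * \<Psi> x)}"

(* phase_rel relates arbitrary functions, but squeezed_states is closed under it, so its elements
   below are exactly the phase classes of squeezed states. *)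
definition CS :: "real \<Rightarrow> (real^'n::finite \<Rightarrow> complex) set set" where
  "CS hbar = squeezed_states hbar // phase_rel hbar"

definition phase_class :: "real \<Rightarrow> (real^'n::finite \<Rightarrow> complex) \<Rightarrow> (real^'n \<Rightarrow> complex) set" where
  "phase_class hbar \<Psi> = phase_rel hbar `` {\<Psi>}"

definition wigner :: "real \<Rightarrow> (real^'n::finite \<Rightarrow> complex) \<Rightarrow> 'n phase \<Rightarrow> complex" where
  "wigner hbar \<Psi> z =
     of_real ((1 / (2 * pi * hbar)) ^ CARD('n)) *
     (LINT y|lborel.
        exp (- (\<i> / of_real hbar) * of_real (mom_part z \<bullet> y)) *
        \<Psi> (pos_part z + (1/2) *\<^sub>R y) * cnj (\<Psi> (pos_part z - (1/2) *\<^sub>R y)))"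

definition has_gaussian_wigner ::
    "real \<Rightarrow> (real^'n::finite \<Rightarrow> complex) \<Rightarrow> 'n phase_mat \<Rightarrow> 'n phase \<Rightarrow> bool" where
  "has_gaussian_wigner hbar \<Psi> G z0 \<longleftrightarrow>
     (\<forall>z. wigner hbar \<Psi> z =
        of_real ((pi * hbar) powr (- real CARD('n)) *
                 exp (- (1 / hbar) * ((G *v (z - z0)) \<bullet> (z - z0)))))"

definition quantum_blob :: "real \<Rightarrow> 'n::finite phase \<Rightarrow> 'n phase_mat \<Rightarrow> 'n phase set" where
  "quantum_blob hbar z0 S = (\<lambda>z. z0 + S *v z) ` cball 0 (sqrt hbar)"

definition QB :: "real \<Rightarrow> 'n::finite phase set set" where
  "QB hbar = {quantum_blob hbar z0 S | z0 S. S \<in> Sp}"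

definition S_matrix :: "real^'n^'n \<Rightarrow> real^'n^'n \<Rightarrow> 'n::finite phase_mat" where
  "S_matrix X Y =
     block_matrix (matrix_sqrt X) 0
       (matrix_inv (matrix_sqrt X) ** Y) (matrix_inv (matrix_sqrt X))"

end

theory Submission
  imports Defs "HOL-Probability.Characteristic_Functions"
begin

text \<open>
  The Wigner transform of \<open>Phi_at hbar X Y z0\<close> is a Gaussian Fourier integral, and it comes out as
  \<open>(pi * hbar) powr (- n) * exp (- |S (z - z0)|^2 / hbar)\<close> with \<open>S = S_matrix X Y\<close>; hence \<open>G = S^T S\<close>.
  Both sides of the correspondence are therefore parametrised by the triples \<open>(X, Y, z0)\<close>, and it suffices that
  the parameters can be recovered from a state class and from a blob, and that every blob arises.
  The Wigner transform, which ignores the phase, determines \<open>G\<close> and \<open>z0\<close>; an ellipsoid determines its centre and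
  its matrix \<open>G\<close>; and \<open>G\<close>, whose lower right block is \<open>X^-1\<close> and whose lower left block is \<open>X^-1 Y\<close>, determines
  \<open>X\<close> and \<open>Y\<close>. Conversely, a matrix \<open>T^T T\<close> with \<open>T\<close> symplectic is itself symplectic, and this forces it to
  have the block form of some \<open>S^T S\<close>.
\<close>

section \<open>Symmetric matrices\<close>

text \<open>Rayleigh quotient argument: the quadratic form of \<open>f\<close> attains its maximum
  on the compact unit sphere of \<open>V\<close>, and a maximiser is an eigenvector. Working in an
  invariant subspace lets the next lemma iterate the construction.\<close>

lemma symmetric_eigenvector:
  fixes f :: "'a::euclidean_space \<Rightarrow> 'a"
  assumes f: "linear f" "\<And>x y. f x \<bullet> y = x \<bullet> f y"
    and V: "subspace V" "V \<noteq> {0}" "f ` V \<subseteq> V"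
  obtains v where "v \<in> V" "norm v = 1" "f v = (f v \<bullet> v) *\<^sub>R v"
proof -
  let ?K = "V \<inter> sphere 0 1"
  obtain u where u: "u \<in> V" "u \<noteq> 0"
    using V subspace_0 by blast
  have "compact ?K"
    by (metis V(1) closed_subspace compact_Int_closed compact_sphere inf_commute)
  moreover have "u /\<^sub>R norm u \<in> ?K"
    using u V(1) by (simp add: subspace_scale)
  moreover have "continuous_on ?K (\<lambda>v. f v \<bullet> v)"
    using f(1) by (intro continuous_intros linear_continuous_on linear_conv_bounded_linear[THEN iffD1])
  ultimately obtain v where v: "v \<in> ?K" and max: "\<And>w. w \<in> ?K \<Longrightarrow> f w \<bullet> w \<le> f v \<bullet> v"
    using continuous_attains_sup[of ?K "\<lambda>v. f v \<bullet> v"] by blast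
  define \<mu> where "\<mu> = f v \<bullet> v"
  \<comment> \<open>\<open>g\<close> is nonnegative on \<open>V\<close> and vanishes at \<open>v\<close>, so its derivative at
    \<open>v\<close> in the direction \<open>w = \<mu> v - f v\<close>, which is \<open>2 |w|^2\<close>, is zero.\<close>
  define g where "g w = \<mu> * (w \<bullet> w) - f w \<bullet> w" for w
  have g_nonneg: "g w \<ge> 0" if "w \<in> V" for w
  proof (cases "w = 0")
    case False
    have "f (w /\<^sub>R norm w) \<bullet> (w /\<^sub>R norm w) \<le> \<mu>"
      unfolding \<mu>_def using that False V(1) by (intro max) (simp add: subspace_scale)
    then have "(f w \<bullet> w) / (norm w)\<^sup>2 \<le> \<mu>"
      by (simp add: linear_scale[OF f(1)] power2_eq_square divide_simps)
    then show ?thesis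
      using False by (simp add: g_def power2_norm_eq_inner divide_simps)
  qed (simp add: g_def linear_0[OF f(1)])
  define w where "w = \<mu> *\<^sub>R v - f v"
  have "w \<in> V"
    using v V by (auto simp: w_def intro!: subspace_diff subspace_scale)
  have vv: "v \<bullet> v = 1"
    using v by (simp add: norm_eq_1)
  have expand: "g (v + t *\<^sub>R w) = 2 * t * (w \<bullet> w) + t\<^sup>2 * g w" for t
  proof -
    have "f w \<bullet> v = f v \<bullet> w"
      using f(2)[of w v] by (simp add: inner_commute)
    then have "g (v + t *\<^sub>R w) = 2 * t * (\<mu> * (v \<bullet> w) - f v \<bullet> w) + t\<^sup>2 * g w"
      by (simp add: g_def \<mu>_def linear_add[OF f(1)] linear_scale[OF f(1)] inner_simps vv
          power2_eq_square algebra_simps inner_commute)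
    moreover have "\<mu> * (v \<bullet> w) - f v \<bullet> w = w \<bullet> w"
      by (simp add: w_def inner_simps inner_commute[of v "f v"])
    ultimately show ?thesis by simp
  qed
  have "w \<bullet> w = 0"
  proof (rule ccontr)
    assume "w \<bullet> w \<noteq> 0"
    let ?b = "w \<bullet> w" and ?c = "g w"
    have c: "?c \<ge> 0" using g_nonneg \<open>w \<in> V\<close> by simp
    \<comment> \<open>With this \<open>t\<close> the value \<open>2 * t * b + t^2 * c\<close>
      becomes \<open>- t^2 * (c + 2)\<close>, which is negative. The summand 1 keeps the denominator
      positive when \<open>c = 0\<close>.\<close>
    define t where "t = - ?b / (?c + 1)"
    have b: "?b = - t * (?c + 1)"
      using c by (simp add: t_def)
    have "0 \<le> g (v + t *\<^sub>R w)"
      using v V \<open>w \<in> V\<close> by (intro g_nonneg subspace_add subspace_scale) auto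
    also have "\<dots> = - (t\<^sup>2 * (?c + 2))"
      unfolding expand b by (simp add: algebra_simps power2_eq_square)
    also have "\<dots> < 0"
      using c \<open>w \<bullet> w \<noteq> 0\<close> b by auto
    finally show False by simp
  qed
  then have "f v = \<mu> *\<^sub>R v"
    by (simp add: w_def)
  with v that show ?thesis
    by (auto simp: \<mu>_def)
qed

text \<open>Induction on the dimension: a unit eigenvector \<open>v\<close> is split off. Its
  orthogonal complement in \<open>V\<close> is again invariant, because \<open>f\<close> is
  self-adjoint, and has dimension one less.\<close>

lemma symmetric_eigenbasis_subspace:
  fixes f :: "'a::euclidean_space \<Rightarrow> 'a"
  assumes f: "linear f" "\<And>x y. f x \<bullet> y = x \<bullet> f y"
    and "subspace V" "f ` V \<subseteq> V"
  shows "\<exists>B\<subseteq>V. finite B \<and> card B = dim V \<and> pairwise orthogonal B \<and>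
           (\<forall>v\<in>B. norm v = 1 \<and> f v = (f v \<bullet> v) *\<^sub>R v)"
  using assms(3,4)
proof (induction "dim V" arbitrary: V)
  case 0
  then show ?case by (intro exI[of _ "{}"]) auto
next
  case (Suc n)
  then have "V \<noteq> {0}" by auto
  then obtain v where v: "v \<in> V" "norm v = 1" "f v = (f v \<bullet> v) *\<^sub>R v"
    using symmetric_eigenvector[OF f] Suc.prems by metis
  define W where "W = {y \<in> V. orthogonal v y}"
  have W: "subspace W"
    unfolding W_def using Suc.prems(1)
    by (auto simp: subspace_def orthogonal_clauses)
  have "dim {y \<in> V. \<forall>x \<in> span {v}. orthogonal x y} + dim (span {v}) = dim V"
    using Suc.prems(1) v(1) by (intro dim_subspace_orthogonal_to_vectors subspace_span span_minimal) auto
  moreover have "(\<forall>x \<in> span {v}. orthogonal x y) \<longleftrightarrow> orthogonal v y" for y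
    unfolding span_singleton orthogonal_def by (auto dest: spec[of _ 1])
  then have WV: "{y \<in> V. \<forall>x \<in> span {v}. orthogonal x y} = W"
    by (simp add: W_def)
  moreover have "dim (span {v}) = 1"
    using v(2) by (subst dim_span, subst dim_eq_card_independent) auto
  ultimately have "n = dim W"
    using Suc.hyps(2) WV by simp
  moreover have "f ` W \<subseteq> W"
  proof
    fix y assume "y \<in> f ` W"
    then obtain x where x: "x \<in> W" "y = f x" by auto
    have "v \<bullet> f x = f v \<bullet> x" by (simp add: f(2))
    also have "\<dots> = (f v \<bullet> v) * (v \<bullet> x)" by (metis v(3) inner_scaleR_left)
    also have "\<dots> = 0" using x by (simp add: W_def orthogonal_def)
    finally show "y \<in> W"
      using x Suc.prems by (auto simp: W_def orthogonal_def)
  qed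
  ultimately obtain B where B: "B \<subseteq> W" "finite B" "card B = dim W" "pairwise orthogonal B"
    "\<forall>v\<in>B. norm v = 1 \<and> f v = (f v \<bullet> v) *\<^sub>R v"
    using Suc.hyps(1) W by metis
  have "v \<notin> B"
    using B(1) v(2) by (auto simp: W_def orthogonal_def)
  then have "card (insert v B) = dim V"
    using B \<open>n = dim W\<close> Suc.hyps(2) by simp
  moreover have "pairwise orthogonal (insert v B)"
    using B(1,4) by (auto simp: pairwise_insert W_def orthogonal_commute)
  ultimately show ?case
    using v B by (intro exI[of _ "insert v B"]) (auto simp: W_def)
qed

section \<open>Diagonalization, square roots and inverses of positive definite matrices\<close>

definition diag_matrix :: "('n \<Rightarrow> 'a::zero) \<Rightarrow> 'a^'n^'n" where
  "diag_matrix d = (\<chi> i j. if i = j then d i else 0)"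

lemma transpose_diag_matrix [simp]: "transpose (diag_matrix d) = diag_matrix d"
  by (auto simp: diag_matrix_def transpose_def vec_eq_iff)

lemma diag_matrix_vector_nth [simp]:
  fixes d :: "'n::finite \<Rightarrow> real"
  shows "(diag_matrix d *v x) $ i = d i * x $ i"
  by (simp add: diag_matrix_def matrix_vector_mult_def if_distrib[of "\<lambda>a. a * _"] cong: if_cong)

lemma diag_matrix_mult [simp]:
  fixes d e :: "'n::finite \<Rightarrow> real"
  shows "diag_matrix d ** diag_matrix e = diag_matrix (\<lambda>i. d i * e i)"
  by (auto simp: diag_matrix_def matrix_matrix_mult_def vec_eq_iff if_distrib[of "\<lambda>a. a * _"] cong: if_cong)

lemma diag_matrix_one: "diag_matrix (\<lambda>_. 1) = mat 1"
  by (auto simp: diag_matrix_def mat_def vec_eq_iff)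

lemma det_diag_matrix: "det (diag_matrix d) = (\<Prod>i\<in>UNIV. d i)"
  for d :: "'n::finite \<Rightarrow> real"
  by (subst det_diagonal) (auto simp: diag_matrix_def)

lemma inner_diag_matrix: "(diag_matrix d *v x) \<bullet> x = (\<Sum>i\<in>UNIV. d i * (x $ i)\<^sup>2)"
  by (simp add: inner_vec_def power2_eq_square mult.assoc)

lemma inner_matrix_transpose: "(A *v x) \<bullet> y = x \<bullet> (transpose A *v y)"
  for A :: "real^'n^'m"
  by (metis dot_lmul_matrix inner_commute transpose_matrix_vector)

lemma sym_matrix_inner: "sym_matrix A \<Longrightarrow> (A *v x) \<bullet> y = x \<bullet> (A *v y)"
  by (metis inner_matrix_transpose sym_matrix_def)

text \<open>An orthonormal eigenbasis has as many elements as the index type, so some bijection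
  \<open>b\<close> makes its vectors the columns of \<open>Q\<close>. The eigenvector equations then
  say \<open>A ** Q = Q ** diag_matrix d\<close>.\<close>

theorem symmetric_matrix_diagonalization:
  fixes A :: "real^'n^'n"
  assumes "sym_matrix A"
  obtains Q d where "orthogonal_matrix Q" "A = Q ** diag_matrix d ** transpose Q"
proof -
  obtain B where B: "finite B" "card B = CARD('n)" "pairwise orthogonal B"
    "\<forall>v\<in>B. norm v = 1 \<and> A *v v = ((A *v v) \<bullet> v) *\<^sub>R v"
    using symmetric_eigenbasis_subspace[of "(*v) A" UNIV] sym_matrix_inner[OF assms] by auto
  then obtain b where b: "bij_betw b (UNIV :: 'n set) B"
    by (metis finite_class.finite_UNIV finite_same_card_bij)
  define Q where "Q = (\<chi> i j. b j $ i)"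
  define d where "d j = (A *v b j) \<bullet> b j" for j
  have col: "column j Q = b j" for j
    by (simp add: Q_def column_def)
  have bB: "b j \<in> B" for j
    using b by (auto simp: bij_betw_def)
  have Q: "orthogonal_matrix Q"
    unfolding orthogonal_matrix_orthonormal_columns col
    using B(3,4) bB bij_betw_imp_inj_on[OF b] unfolding pairwise_def by (metis injD)
  have "A *v b j = d j *\<^sub>R b j" for j
    using B(4) bB unfolding d_def by blast
  then have "A ** Q = Q ** diag_matrix d"
    by (simp add: vec_eq_iff matrix_matrix_mult_def matrix_vector_mult_def Q_def diag_matrix_def
        if_distrib[of "(*) _"] mult.commute cong: if_cong)
  then have "A = Q ** diag_matrix d ** transpose Q"
    by (metis Q matrix_mul_assoc matrix_mul_rid orthogonal_matrix_def)
  with Q that show ?thesis by blast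
qed

text \<open>The eigenvalue \<open>d i\<close> is the value of the quadratic form at the
  \<open>i\<close>-th column of \<open>Q\<close>, hence positive.\<close>

lemma sym_pos_def_diagonalization:
  assumes "sym_pos_def A"
  obtains Q d where "orthogonal_matrix Q" "A = Q ** diag_matrix d ** transpose Q" "\<And>i. d i > 0"
proof -
  obtain Q d where Q: "orthogonal_matrix Q" and A: "A = Q ** diag_matrix d ** transpose Q"
    using assms symmetric_matrix_diagonalization unfolding sym_pos_def_def by blast
  have "d i > 0" for i
  proof -
    let ?v = "Q *v axis i 1"
    have Qtv: "transpose Q *v ?v = axis i 1"
      by (metis Q matrix_vector_mul_assoc matrix_vector_mul_lid orthogonal_matrix_def)
    then have "?v \<noteq> 0"
      by (metis axis_eq_0_iff matrix_vector_mult_0_right zero_neq_one)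
    then have "0 < (A *v ?v) \<bullet> ?v"
      using assms by (simp add: sym_pos_def_def)
    also have "\<dots> = (diag_matrix d *v axis i 1) \<bullet> axis i 1"
      by (metis A Qtv inner_matrix_transpose matrix_vector_mul_assoc)
    also have "\<dots> = d i"
      by (simp add: inner_axis)
    finally show ?thesis .
  qed
  with Q A that show ?thesis by blast
qed

lemma sym_pos_def_conjugate_diag:
  assumes "orthogonal_matrix Q" "\<And>i. d i > 0"
  shows "sym_pos_def (Q ** diag_matrix d ** transpose Q)"
  unfolding sym_pos_def_def sym_matrix_def
proof (intro conjI allI impI)
  show "transpose (Q ** diag_matrix d ** transpose Q) = Q ** diag_matrix d ** transpose Q"
    by (simp add: matrix_transpose_mul matrix_mul_assoc)
next
  fix x :: "real^'a" assume "x \<noteq> 0"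
  define y where "y = transpose Q *v x"
  have "Q *v y = x"
    unfolding y_def by (metis assms(1) matrix_vector_mul_assoc matrix_vector_mul_lid orthogonal_matrix_def)
  with \<open>x \<noteq> 0\<close> obtain i where i: "y $ i \<noteq> 0"
    by (metis matrix_vector_mult_0_right vec_eq_iff zero_index)
  have "((Q ** diag_matrix d ** transpose Q) *v x) \<bullet> x = (diag_matrix d *v y) \<bullet> y"
    unfolding y_def by (metis inner_matrix_transpose matrix_vector_mul_assoc)
  also have "\<dots> = (\<Sum>i\<in>UNIV. d i * (y $ i)\<^sup>2)"
    by (rule inner_diag_matrix)
  also have "\<dots> > 0"
    using i assms(2) less_imp_le[OF assms(2)] by (intro sum_pos2[of _ i]) auto
  finally show "((Q ** diag_matrix d ** transpose Q) *v x) \<bullet> x > 0" .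
qed

text \<open>The inner factor \<open>transpose Q ** Q\<close> cancels, so for a fixed
  \<open>Q\<close> products are computed on the eigenvalues alone. Square roots and inverses are
  then obtained eigenvalue by eigenvalue.\<close>

lemma conjugate_diag_mult:
  fixes d e :: "'n::finite \<Rightarrow> real"
  assumes "orthogonal_matrix Q"
  shows "(Q ** diag_matrix d ** transpose Q) ** (Q ** diag_matrix e ** transpose Q)
    = Q ** diag_matrix (\<lambda>i. d i * e i) ** transpose Q"
proof -
  have "(Q ** diag_matrix d ** transpose Q) ** (Q ** diag_matrix e ** transpose Q)
      = Q ** diag_matrix d ** (transpose Q ** Q) ** diag_matrix e ** transpose Q"
    by (simp only: matrix_mul_assoc)
  also have "\<dots> = Q ** (diag_matrix d ** diag_matrix e) ** transpose Q"
    using assms by (simp only: orthogonal_matrix_def matrix_mul_rid matrix_mul_assoc)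
  finally show ?thesis by simp
qed

lemma det_conjugate_diag:
  fixes d :: "'n::finite \<Rightarrow> real"
  assumes "orthogonal_matrix Q"
  shows "det (Q ** diag_matrix d ** transpose Q) = (\<Prod>i\<in>UNIV. d i)"
proof -
  have "det Q * det Q = 1"
    using assms by (metis det_I det_mul det_transpose orthogonal_matrix_def)
  then show ?thesis
    by (simp add: det_mul det_diag_matrix)
qed

lemma matrix_inv_unique:
  fixes A B :: "real^'n^'n"
  assumes "A ** B = mat 1"
  shows "matrix_inv A = B"
proof -
  have "B ** A = mat 1"
    using assms matrix_left_right_inverse by blast
  then have "A ** matrix_inv A = mat 1"
    unfolding matrix_inv_def using assms by (metis (mono_tags, lifting) someI_ex)
  then show ?thesis
    by (metis \<open>B ** A = mat 1\<close> matrix_mul_assoc matrix_mul_lid matrix_mul_rid)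
qed

lemma matrix_inv_conjugate_diag:
  fixes d :: "'n::finite \<Rightarrow> real"
  assumes "orthogonal_matrix Q" "\<And>i. d i \<noteq> 0"
  shows "matrix_inv (Q ** diag_matrix d ** transpose Q) = Q ** diag_matrix (\<lambda>i. 1 / d i) ** transpose Q"
proof (rule matrix_inv_unique)
  show "(Q ** diag_matrix d ** transpose Q) ** (Q ** diag_matrix (\<lambda>i. 1 / d i) ** transpose Q) = mat 1"
    using assms by (simp add: conjugate_diag_mult diag_matrix_one)
      (metis orthogonal_matrix_def)
qed

text \<open>Needed because \<open>matrix_sqrt\<close> is a definite description. With
  \<open>D = R - S\<close> the hypothesis reads \<open>R ** D + D ** S = 0\<close>, which avoids
  assuming that \<open>R\<close> and \<open>S\<close> commute; pairing this with the eigenvectors of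
  \<open>D\<close> shows \<open>D = 0\<close>.\<close>

lemma sym_pos_def_sqrt_unique:
  assumes R: "sym_pos_def R" and S: "sym_pos_def S" and eq: "R ** R = S ** S"
  shows "R = S"
proof -
  define D where "D = R - S"
  have "sym_matrix D"
    using R S by (simp add: D_def sym_pos_def_def sym_matrix_def transpose_def vec_eq_iff)
  then obtain Q d where Q: "orthogonal_matrix Q" and D: "D = Q ** diag_matrix d ** transpose Q"
    using symmetric_matrix_diagonalization by blast
  have "d i = 0" for i
  proof -
    let ?v = "Q *v axis i 1"
    have Qtv: "transpose Q *v ?v = axis i 1"
      by (metis Q matrix_vector_mul_assoc matrix_vector_mul_lid orthogonal_matrix_def)
    then have "?v \<noteq> 0"
      by (metis axis_eq_0_iff matrix_vector_mult_0_right zero_neq_one)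
    have "diag_matrix d *v axis i 1 = d i *\<^sub>R axis i 1"
      by (auto simp: vec_eq_iff axis_def)
    then have Dv: "D *v ?v = d i *\<^sub>R ?v"
      unfolding D by (metis Qtv matrix_vector_mul_assoc matrix_vector_mult_scaleR)
    \<comment> \<open>So every eigenvalue of \<open>D\<close> annihilates a positive number.\<close>
    have "R ** D + D ** S = 0"
      using eq by (simp add: D_def matrix_matrix_mult_def vec_eq_iff algebra_simps sum_subtractf)
    then have "0 = (R *v (D *v ?v)) \<bullet> ?v + (D *v (S *v ?v)) \<bullet> ?v"
      by (metis inner_add_left inner_zero_left matrix_vector_mul_assoc matrix_vector_mult_0
          matrix_vector_mult_add_rdistrib)
    also have "(D *v (S *v ?v)) \<bullet> ?v = (S *v ?v) \<bullet> (D *v ?v)"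
      using \<open>sym_matrix D\<close> by (rule sym_matrix_inner)
    finally have "0 = d i * ((R *v ?v) \<bullet> ?v + (S *v ?v) \<bullet> ?v)"
      by (simp add: Dv matrix_vector_mult_scaleR algebra_simps)
    moreover have "(R *v ?v) \<bullet> ?v + (S *v ?v) \<bullet> ?v > 0"
      using R S \<open>?v \<noteq> 0\<close> unfolding sym_pos_def_def by (blast intro: add_pos_pos)
    ultimately show ?thesis by simp
  qed
  then have "d = (\<lambda>_. 0)" by auto
  then have "D = 0"
    by (simp add: D diag_matrix_def matrix_matrix_mult_def vec_eq_iff)
  then show ?thesis by (simp add: D_def)
qed

lemma matrix_sqrt:
  assumes "sym_pos_def X"
  shows "sym_pos_def (matrix_sqrt X)" "matrix_sqrt X ** matrix_sqrt X = X"
proof -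
  obtain Q d where Q: "orthogonal_matrix Q" and X: "X = Q ** diag_matrix d ** transpose Q"
    and d: "\<And>i. d i > 0"
    using assms sym_pos_def_diagonalization by blast
  define R where "R = Q ** diag_matrix (\<lambda>i. sqrt (d i)) ** transpose Q"
  have "sym_pos_def R"
    unfolding R_def using Q d by (intro sym_pos_def_conjugate_diag) auto
  moreover have "R ** R = X"
    unfolding R_def X using Q d by (simp add: conjugate_diag_mult less_imp_le)
  ultimately have "\<exists>!R. sym_pos_def R \<and> R ** R = X"
    using sym_pos_def_sqrt_unique by metis
  from theI'[OF this] show "sym_pos_def (matrix_sqrt X)" "matrix_sqrt X ** matrix_sqrt X = X"
    unfolding matrix_sqrt_def by auto
qed

lemma sym_pos_def_inverse:
  assumes "sym_pos_def X"
  shows "sym_pos_def (matrix_inv X)" "X ** matrix_inv X = mat 1" "matrix_inv X ** X = mat 1"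
proof -
  obtain Q d where Q: "orthogonal_matrix Q" and X: "X = Q ** diag_matrix d ** transpose Q"
    and d: "\<And>i. d i > 0"
    using assms sym_pos_def_diagonalization by blast
  have inv: "matrix_inv X = Q ** diag_matrix (\<lambda>i. 1 / d i) ** transpose Q"
    unfolding X using Q d by (intro matrix_inv_conjugate_diag) (auto simp: less_imp_neq[symmetric])
  show "sym_pos_def (matrix_inv X)"
    unfolding inv using Q d by (intro sym_pos_def_conjugate_diag) auto
  have "(\<lambda>i. d i * (1 / d i)) = (\<lambda>_. 1)"
    using d by (auto simp: less_imp_neq[symmetric])
  then show "X ** matrix_inv X = mat 1"
    unfolding inv unfolding X conjugate_diag_mult[OF Q] using Q
    by (simp add: diag_matrix_one orthogonal_matrix_def)
  then show "matrix_inv X ** X = mat 1"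
    using matrix_left_right_inverse by blast
qed

section \<open>Gaussian integrals\<close>

lemma nn_integral_lborel_translate:
  fixes f :: "'a::euclidean_space \<Rightarrow> ennreal"
  assumes [measurable]: "f \<in> borel_measurable borel"
  shows "(\<integral>\<^sup>+x. f (c + x) \<partial>lborel) = (\<integral>\<^sup>+x. f x \<partial>lborel)"
proof -
  have "(\<integral>\<^sup>+x. f x \<partial>lborel) = (\<integral>\<^sup>+x. f x \<partial>distr lborel borel ((+) c))"
    by (simp add: lborel_distr_plus)
  also have "\<dots> = (\<integral>\<^sup>+x. f (c + x) \<partial>lborel)"
    by (subst nn_integral_distr) auto
  finally show ?thesis by simp
qed

text \<open>Uniqueness of Haar measure: for the image measure \<open>m\<close>, Fubini and translation invariance turn
  \<open>m A * lborel B\<close> into \<open>lborel A * m (- B)\<close>; now take for \<open>B\<close> the unit ball, which the rotation preserves.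
  The library result \<open>measure_orthogonal_image\<close> needs a well-ordered index type.\<close>

lemma lborel_distr_orthogonal:
  fixes Q :: "'a::euclidean_space \<Rightarrow> 'a"
  assumes Q: "orthogonal_transformation Q"
  shows "distr lborel borel Q = lborel"
proof (rule measure_eqI)
  fix A assume "A \<in> sets (distr lborel borel Q)"
  then have A[measurable]: "A \<in> sets borel" by simp
  have lin: "linear Q"
    using Q by (simp add: orthogonal_transformation_def)
  have [measurable]: "Q \<in> borel_measurable borel"
    using lin by (intro borel_measurable_continuous_onI linear_continuous_on) (simp add: linear_conv_bounded_linear)
  define a :: "'a \<Rightarrow> ennreal" where "a = indicator A"
  define b :: "'a \<Rightarrow> ennreal" where "b = indicator (ball 0 1)"
  have [measurable]: "a \<in> borel_measurable borel" "b \<in> borel_measurable borel"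
    by (auto simp: a_def b_def intro!: borel_measurable_indicator)
  have bQ: "b (- Q x) = b x" for x
    using Q by (simp add: b_def orthogonal_transformation_norm indicator_def dist_norm)
  have "(\<integral>\<^sup>+x. a (Q x) \<partial>lborel) * (\<integral>\<^sup>+y. b y \<partial>lborel)
      = (\<integral>\<^sup>+x. (\<integral>\<^sup>+y. a (Q x) * b (- Q x + y) \<partial>lborel) \<partial>lborel)"
    by (simp add: nn_integral_cmult nn_integral_multc nn_integral_lborel_translate del: uminus_add_conv_diff)
  also have "\<dots> = (\<integral>\<^sup>+y. (\<integral>\<^sup>+x. a (Q x) * b (- Q x + y) \<partial>lborel) \<partial>lborel)"
    by (rule lborel_pair.Fubini'[symmetric]) measurable
  also have "\<dots> = (\<integral>\<^sup>+y. (\<integral>\<^sup>+x. a (y + Q x) * b (- Q x) \<partial>lborel) \<partial>lborel)"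
  proof (rule nn_integral_cong)
    fix y :: 'a
    \<comment> \<open>Translating \<open>x\<close> by \<open>u\<close> removes \<open>y\<close> from
      the argument of \<open>b\<close> and moves it into that of \<open>a\<close>.\<close>
    obtain u where u: "Q u = y"
      using orthogonal_transformation_surj[OF Q] by (metis surjD)
    have "(\<integral>\<^sup>+x. a (Q x) * b (- Q x + y) \<partial>lborel)
        = (\<integral>\<^sup>+x. a (Q (u + x)) * b (- Q (u + x) + y) \<partial>lborel)"
      by (rule nn_integral_lborel_translate[symmetric]) measurable
    then show "(\<integral>\<^sup>+x. a (Q x) * b (- Q x + y) \<partial>lborel) = (\<integral>\<^sup>+x. a (y + Q x) * b (- Q x) \<partial>lborel)"
      by (simp add: linear_add[OF lin] u)
  qed
  also have "\<dots> = (\<integral>\<^sup>+x. (\<integral>\<^sup>+y. a (y + Q x) * b (- Q x) \<partial>lborel) \<partial>lborel)"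
    by (rule lborel_pair.Fubini') measurable
  also have "\<dots> = (\<integral>\<^sup>+y. a y \<partial>lborel) * (\<integral>\<^sup>+x. b x \<partial>lborel)"
    by (simp add: bQ nn_integral_cmult nn_integral_multc add.commute[of _ "Q _"] nn_integral_lborel_translate)
  finally have "(\<integral>\<^sup>+x. a (Q x) \<partial>lborel) * emeasure lborel (ball 0 1 :: 'a set)
      = (\<integral>\<^sup>+y. a y \<partial>lborel) * emeasure lborel (ball 0 1 :: 'a set)"
    by (simp add: b_def)
  \<comment> \<open>The measure of the ball is finite and nonzero, so it can be cancelled in the
    extended reals.\<close>
  moreover have "emeasure lborel (ball 0 1 :: 'a set) \<noteq> \<infinity>"
    using emeasure_lborel_ball_finite[of "0::'a" 1] by auto
  moreover have "emeasure lborel (ball 0 1 :: 'a set) \<noteq> 0"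
    using open_not_negligible[of "ball 0 1 :: 'a set"]
    by (auto simp: negligible_iff_emeasure0 null_sets_def emeasure_completion)
  ultimately have "(\<integral>\<^sup>+x. a (Q x) \<partial>lborel) = (\<integral>\<^sup>+y. a y \<partial>lborel)"
    by (simp add: mult.commute[of _ "emeasure lborel (ball 0 1 :: 'a set)"] ennreal_mult_cancel_left)
  then have "(\<integral>\<^sup>+x. indicator A x \<partial>distr lborel borel Q) = (\<integral>\<^sup>+x. indicator A x \<partial>lborel)"
    by (subst nn_integral_distr) (auto simp: a_def)
  then show "emeasure (distr lborel borel Q) A = emeasure lborel A"
    by simp
qed simp

lemma lborel_integral_orthogonal:
  fixes Q :: "real^'n^'n" and f :: "real^'n \<Rightarrow> 'b::{banach, second_countable_topology}"
  assumes "orthogonal_matrix Q" and [measurable]: "f \<in> borel_measurable borel"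
  shows "(LINT x|lborel. f (Q *v x)) = (LINT x|lborel. f x)"
proof -
  have [measurable]: "(*v) Q \<in> borel_measurable borel"
    by (intro borel_measurable_continuous_onI linear_continuous_on) (simp flip: linear_conv_bounded_linear)
  have "orthogonal_transformation ((*v) Q)"
    by (simp add: assms(1) orthogonal_transformation_matrix)
  then have "(LINT x|lborel. f x) = (LINT x|distr lborel borel ((*v) Q). f x)"
    by (simp add: lborel_distr_orthogonal)
  also have "\<dots> = (LINT x|lborel. f (Q *v x))"
    by (subst integral_distr) auto
  finally show ?thesis by simp
qed

text \<open>Lebesgue measure on \<open>real^'n\<close> is the image of a product measure indexed by
  the basis vectors, whereas the factors \<open>f\<close> are indexed by coordinates; the work lies
  in translating between the two index sets.\<close>

lemma lborel_integral_prod_vec: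
  fixes f :: "'n::finite \<Rightarrow> real \<Rightarrow> 'b::{real_normed_field, banach, second_countable_topology}"
  assumes int: "\<And>i. integrable lborel (f i)"
  shows "(LINT x|lborel. (\<Prod>i\<in>UNIV. f i ((x :: real^'n) $ i))) = (\<Prod>i\<in>UNIV. LINT u|lborel. f i u)"
proof -
  \<comment> \<open>At \<open>axis i 1\<close> the choice can only return \<open>i\<close>. At any
    other vector \<open>g b\<close> is still one of the \<open>f i\<close>, so integrability holds
    for every \<open>b\<close>.\<close>
  define g where "g b = f (SOME i. b = axis i 1)" for b :: "real^'n"
  have g: "g (axis i 1) = f i" for i
    by (simp add: g_def axis_eq_axis)
  have B: "Basis = range (\<lambda>i. axis i 1 :: real^'n)"
    by (auto simp: Basis_vec_def)
  have inj: "inj (\<lambda>i. axis i 1 :: real^'n)"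
    by (auto simp: inj_def axis_eq_axis)
  have reindex: "(\<Prod>b\<in>Basis. h b) = (\<Prod>i\<in>UNIV. h (axis i 1))" for h :: "real^'n \<Rightarrow> 'b"
    unfolding B by (subst prod.reindex[OF inj]) simp
  have int_g: "integrable lborel (g b)" for b
    using int by (simp add: g_def)
  have [measurable]: "g b \<in> borel_measurable borel" for b
    using borel_measurable_integrable[OF int_g[of b]] by simp
  interpret product_sigma_finite "\<lambda>_::real^'n. lborel :: real measure" ..
  have "(LINT x|lborel. (\<Prod>i\<in>UNIV. f i ((x :: real^'n) $ i))) = (LINT x|lborel. (\<Prod>b\<in>Basis. g b (x \<bullet> b)))"
    by (simp add: reindex g inner_axis)
  also have "\<dots> = (LINT y|(\<Pi>\<^sub>M b\<in>Basis. lborel). (\<Prod>b\<in>Basis. g b ((\<Sum>c\<in>Basis. y c *\<^sub>R c) \<bullet> b)))"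
    by (subst lborel_eq, subst integral_distr) auto
  also have "\<dots> = (LINT y|(\<Pi>\<^sub>M b\<in>Basis. lborel). (\<Prod>b\<in>Basis. g b (y b)))"
    by simp
  also have "\<dots> = (\<Prod>b\<in>Basis. LINT u|lborel. g b u)"
    using int_g by (intro product_integral_prod) auto
  also have "\<dots> = (\<Prod>i\<in>UNIV. LINT u|lborel. f i u)"
    by (simp add: reindex g)
  finally show ?thesis .
qed

section \<open>Fourier transforms of Gaussians\<close>

text \<open>Up to the factor \<open>sqrt (2 * pi)\<close> this is the characteristic function of the
  standard normal distribution at \<open>- k\<close>.\<close>

lemma std_gaussian_fourier:
  fixes k :: real
  shows "integrable lborel (\<lambda>u. exp (- (of_real (u\<^sup>2 / 2) + \<i> * of_real (k * u))))"
    and "(LINT u|lborel. exp (- (of_real (u\<^sup>2 / 2) + \<i> * of_real (k * u)))) = of_real (sqrt (2 * pi) * exp (- k\<^sup>2 / 2))"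
proof -
  have eq: "exp (- (of_real (u\<^sup>2 / 2) + \<i> * of_real (k * u)))
      = of_real (sqrt (2 * pi)) * (std_normal_density u *\<^sub>R iexp (- k * u))" for u
  proof -
    have "exp (- (of_real (u\<^sup>2 / 2) + \<i> * of_real (k * u))) = of_real (exp (- u\<^sup>2 / 2)) * iexp (- k * u)"
      unfolding exp_of_real[symmetric] exp_add[symmetric] by simp
    then show ?thesis
      by (simp add: std_normal_density_def scaleR_conv_of_real)
  qed
  have "integrable std_normal_distribution (\<lambda>u. iexp (- k * u))"
  proof -
    interpret prob_space std_normal_distribution
      by (rule prob_space_normal_density) simp
    show ?thesis by (intro integrable_iexp) auto
  qed
  then have int: "integrable lborel (\<lambda>u. std_normal_density u *\<^sub>R iexp (- k * u))"
    by (subst (asm) integrable_density) auto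
  show "integrable lborel (\<lambda>u. exp (- (of_real (u\<^sup>2 / 2) + \<i> * of_real (k * u))))"
    unfolding eq using int by (rule integrable_mult_right)
  have "(LINT u|lborel. std_normal_density u *\<^sub>R iexp (- k * u)) = char std_normal_distribution (- k)"
    unfolding char_def by (subst integral_density) auto
  then show "(LINT u|lborel. exp (- (of_real (u\<^sup>2 / 2) + \<i> * of_real (k * u)))) = of_real (sqrt (2 * pi) * exp (- k\<^sup>2 / 2))"
    unfolding eq integral_mult_right_zero by (simp only: char_std_normal_distribution) simp
qed

lemma gaussian_fourier_real:
  fixes k d :: real
  assumes "d > 0"
  shows "integrable lborel (\<lambda>u. exp (- (of_real (d * u\<^sup>2 / 2) + \<i> * of_real (k * u))))"
    and "(LINT u|lborel. exp (- (of_real (d * u\<^sup>2 / 2) + \<i> * of_real (k * u))))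
      = of_real (sqrt (2 * pi / d) * exp (- k\<^sup>2 / (2 * d)))"
proof -
  define F where "F u = exp (- (of_real (u\<^sup>2 / 2) + \<i> * of_real (k / sqrt d * u)))" for u :: real
  \<comment> \<open>The summand 0 puts the rescaled argument into the shape of the affine
    substitution rule.\<close>
  have eq: "exp (- (of_real (d * u\<^sup>2 / 2) + \<i> * of_real (k * u))) = F (0 + sqrt d * u)" for u
    using assms by (simp add: F_def power_mult_distrib)
  have F: "integrable lborel F"
    unfolding F_def by (rule std_gaussian_fourier)
  have int_F: "(LINT u|lborel. F u) = of_real (sqrt (2 * pi) * exp (- k\<^sup>2 / (2 * d)))"
    unfolding F_def std_gaussian_fourier(2) using assms by (simp add: power_divide mult.commute)
  show "integrable lborel (\<lambda>u. exp (- (of_real (d * u\<^sup>2 / 2) + \<i> * of_real (k * u))))"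
    unfolding eq using F assms by (intro lborel_integrable_real_affine) simp_all
  have "(LINT u|lborel. F u) = \<bar>sqrt d\<bar> *\<^sub>R (LINT u|lborel. F (0 + sqrt d * u))"
    using assms by (intro lborel_integral_real_affine) simp
  then have "(LINT u|lborel. F (0 + sqrt d * u)) = (LINT u|lborel. F u) /\<^sub>R sqrt d"
    using assms by simp
  then show "(LINT u|lborel. exp (- (of_real (d * u\<^sup>2 / 2) + \<i> * of_real (k * u))))
      = of_real (sqrt (2 * pi / d) * exp (- k\<^sup>2 / (2 * d)))"
    unfolding eq int_F by (simp add: scaleR_conv_of_real real_sqrt_divide field_simps)
qed

text \<open>Rotating by \<open>Q\<close> into an eigenbasis of \<open>A\<close> turns the integral
  into a product of one-dimensional ones. The product of the eigenvalues reassembles to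
  \<open>det A\<close>, and the sum of the exponents to the quadratic form of
  \<open>matrix_inv A\<close>.\<close>

theorem gaussian_fourier:
  fixes A :: "real^'n^'n" and k :: "real^'n"
  assumes "sym_pos_def A"
  shows "det A > 0"
    and "(LINT y|lborel. exp (- (of_real ((A *v y) \<bullet> y / 2) + \<i> * of_real (k \<bullet> y))))
      = of_real ((2 * pi) powr (real CARD('n) / 2) * det A powr (- 1 / 2) * exp (- ((matrix_inv A *v k) \<bullet> k) / 2))"
proof -
  obtain Q d where Q: "orthogonal_matrix Q" and A: "A = Q ** diag_matrix d ** transpose Q"
    and d: "\<And>i. d i > 0"
    using assms sym_pos_def_diagonalization by blast
  have det: "det A = (\<Prod>i\<in>UNIV. d i)"
    unfolding A by (rule det_conjugate_diag[OF Q])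
  then show "det A > 0"
    using d by (simp add: prod_pos)
  define l where "l = transpose Q *v k"
  have inv: "(matrix_inv A *v k) \<bullet> k = (\<Sum>i\<in>UNIV. 1 / d i * (l $ i)\<^sup>2)"
  proof -
    have "(matrix_inv A *v k) \<bullet> k = ((Q ** diag_matrix (\<lambda>i. 1 / d i) ** transpose Q) *v k) \<bullet> k"
      unfolding A using Q d by (subst matrix_inv_conjugate_diag) (auto simp: less_imp_neq[symmetric])
    also have "\<dots> = (diag_matrix (\<lambda>i. 1 / d i) *v l) \<bullet> l"
      unfolding l_def by (metis inner_matrix_transpose matrix_vector_mul_assoc)
    finally show ?thesis by (simp only: inner_diag_matrix)
  qed
  have quad: "(A *v (Q *v y)) \<bullet> (Q *v y) = (\<Sum>i\<in>UNIV. d i * (y $ i)\<^sup>2)" for y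
  proof -
    have "transpose Q *v (Q *v y) = y"
      by (metis Q matrix_vector_mul_assoc matrix_vector_mul_lid orthogonal_matrix_def)
    then have "(A *v (Q *v y)) \<bullet> (Q *v y) = (diag_matrix d *v y) \<bullet> y"
      unfolding A by (metis inner_matrix_transpose matrix_vector_mul_assoc)
    then show ?thesis by (simp only: inner_diag_matrix)
  qed
  have lin: "k \<bullet> (Q *v y) = (\<Sum>i\<in>UNIV. l $ i * y $ i)" for y
  proof -
    have "k \<bullet> (Q *v y) = l \<bullet> y"
      unfolding l_def by (metis inner_matrix_transpose transpose_transpose)
    then show ?thesis by (simp add: inner_vec_def)
  qed
  have "(LINT y|lborel. exp (- (of_real ((A *v y) \<bullet> y / 2) + \<i> * of_real (k \<bullet> y))))
      = (LINT y|lborel. exp (- (of_real ((A *v (Q *v y)) \<bullet> (Q *v y) / 2) + \<i> * of_real (k \<bullet> (Q *v y)))))"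
    using Q by (intro lborel_integral_orthogonal[symmetric] borel_measurable_continuous_onI continuous_intros
        linear_continuous_on) (simp_all flip: linear_conv_bounded_linear)
  also have "\<dots> = (LINT y|lborel. (\<Prod>i\<in>UNIV. exp (- (of_real (d i * ((y :: real^'n) $ i)\<^sup>2 / 2) + \<i> * of_real (l $ i * y $ i)))))"
    unfolding quad lin
    by (simp add: exp_sum[symmetric] sum.distrib sum_distrib_left sum_divide_distrib sum_negf sum_subtractf)
  also have "\<dots> = (\<Prod>i\<in>UNIV. LINT u|lborel. exp (- (of_real (d i * u\<^sup>2 / 2) + \<i> * of_real (l $ i * u))))"
    using d by (intro lborel_integral_prod_vec gaussian_fourier_real)
  also have "\<dots> = of_real (\<Prod>i\<in>UNIV. sqrt (2 * pi) * (d i powr (- 1 / 2) * exp (- (1 / d i * (l $ i)\<^sup>2 / 2))))"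
    unfolding gaussian_fourier_real(2)[OF d] of_real_prod[symmetric] using d
    by (simp add: real_sqrt_divide powr_minus_divide powr_half_sqrt less_imp_le mult_ac)
  also have "(\<Prod>i\<in>UNIV. sqrt (2 * pi) * (d i powr (- 1 / 2) * exp (- (1 / d i * (l $ i)\<^sup>2 / 2))))
      = sqrt (2 * pi) ^ CARD('n) * (det A powr (- 1 / 2) * exp (- ((matrix_inv A *v k) \<bullet> k) / 2))"
    unfolding inv det prod.distrib using d
    by (simp add: less_imp_le exp_sum[symmetric] sum_negf sum_divide_distrib prod_powr_distrib)
  also have "sqrt (2 * pi) ^ CARD('n) = (2 * pi) powr (real CARD('n) / 2)"
    by (simp add: powr_half_sqrt[symmetric] powr_realpow[symmetric] powr_powr)
  finally show "(LINT y|lborel. exp (- (of_real ((A *v y) \<bullet> y / 2) + \<i> * of_real (k \<bullet> y))))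
      = of_real ((2 * pi) powr (real CARD('n) / 2) * det A powr (- 1 / 2) * exp (- ((matrix_inv A *v k) \<bullet> k) / 2))"
    by (simp add: mult.assoc)
qed

section \<open>Symplectic matrices and ellipsoids\<close>

lemma sum_UNIV_Plus:
  "(\<Sum>i\<in>(UNIV :: ('a::finite + 'b::finite) set). f i) = (\<Sum>i\<in>UNIV. f (Inl i)) + (\<Sum>i\<in>UNIV. f (Inr i))"
  by (simp add: sum.Plus flip: UNIV_Plus_UNIV)

lemma block_matrix_nth [simp]:
  "block_matrix A B C D $ Inl i $ Inl j = A $ i $ j"
  "block_matrix A B C D $ Inl i $ Inr j = B $ i $ j"
  "block_matrix A B C D $ Inr i $ Inl j = C $ i $ j"
  "block_matrix A B C D $ Inr i $ Inr j = D $ i $ j"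
  by (simp_all add: block_matrix_def)

lemma vec_eq_iff_Plus: "M = N \<longleftrightarrow> (\<forall>i. M $ Inl i = N $ Inl i) \<and> (\<forall>i. M $ Inr i = N $ Inr i)"
  for M N :: "'a^('n::finite + 'm::finite)"
  by (simp add: vec_eq_iff split_sum_all)

lemma block_matrix_eq_iff [simp]:
  "block_matrix A B C D = block_matrix A' B' C' D' \<longleftrightarrow> A = A' \<and> B = B' \<and> C = C' \<and> D = D'"
  by (auto simp: vec_eq_iff_Plus) (auto simp: vec_eq_iff)

lemma block_matrix_cases:
  obtains A B C D where "M = block_matrix A B C D"
proof
  show "M = block_matrix (\<chi> i j. M $ Inl i $ Inl j) (\<chi> i j. M $ Inl i $ Inr j)
      (\<chi> i j. M $ Inr i $ Inl j) (\<chi> i j. M $ Inr i $ Inr j)"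
    by (simp add: vec_eq_iff_Plus)
qed

lemma block_matrix_mult:
  "block_matrix A B C D ** block_matrix A' B' C' D'
    = block_matrix (A ** A' + B ** C') (A ** B' + B ** D') (C ** A' + D ** C') (C ** B' + D ** D')"
  by (simp add: vec_eq_iff_Plus matrix_matrix_mult_def sum_UNIV_Plus)

lemma transpose_block_matrix:
  "transpose (block_matrix A B C D) = block_matrix (transpose A) (transpose C) (transpose B) (transpose D)"
  by (simp add: vec_eq_iff_Plus transpose_def)

lemma mat_1_block_matrix: "mat 1 = block_matrix (mat 1) 0 0 (mat 1)"
  by (simp add: vec_eq_iff_Plus mat_def)

lemma uminus_block_matrix: "- block_matrix A B C D = block_matrix (- A) (- B) (- C) (- D)"
  by (simp add: vec_eq_iff_Plus)

lemma pos_part_block_matrix: "pos_part (block_matrix A B C D *v z) = A *v pos_part z + B *v mom_part z"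
  by (simp add: vec_eq_iff pos_part_def mom_part_def matrix_vector_mult_def sum_UNIV_Plus)

lemma mom_part_block_matrix: "mom_part (block_matrix A B C D *v z) = C *v pos_part z + D *v mom_part z"
  by (simp add: vec_eq_iff pos_part_def mom_part_def matrix_vector_mult_def sum_UNIV_Plus)

lemma inner_phase: "z \<bullet> w = pos_part z \<bullet> pos_part w + mom_part z \<bullet> mom_part w"
  by (simp add: inner_vec_def pos_part_def mom_part_def sum_UNIV_Plus)

lemma pos_part_diff: "pos_part (z - w) = pos_part z - pos_part w"
  by (simp add: pos_part_def vec_eq_iff)

lemma mom_part_diff: "mom_part (z - w) = mom_part z - mom_part w"
  by (simp add: mom_part_def vec_eq_iff)

lemma matrix_mult_uminus [simp]:
  fixes A :: "real^'n^'m" and B :: "real^'k^'n"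
  shows "(- A) ** B = - (A ** B)" "A ** (- B) = - (A ** B)"
  by (simp_all add: matrix_matrix_mult_def vec_eq_iff sum_negf)

lemma matrix_mult_zero [simp]:
  fixes A :: "real^'n^'m"
  shows "(0 :: real^'n^'k) ** B = 0" "A ** (0 :: real^'k^'n) = 0"
  by (simp_all add: matrix_matrix_mult_def vec_eq_iff)

lemma matrix_add_rdistrib: "(A + B) ** C = A ** C + B ** C"
  for A B :: "'a::semiring_1^'n^'m"
  by (simp add: matrix_matrix_mult_def vec_eq_iff distrib_right sum.distrib)

lemma transpose_zero [simp]: "transpose 0 = 0"
  by (simp add: transpose_def vec_eq_iff)

section \<open>Symplectic matrices and positive quadratic forms\<close>

lemma sympl_J_square: "sympl_J ** sympl_J = - mat 1"
  by (simp add: sympl_J_def block_matrix_mult mat_1_block_matrix uminus_block_matrix)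

text \<open>Multiplying the defining relation by \<open>- sympl_J\<close> from the left and using
  \<open>sympl_J_square\<close> exhibits an explicit left inverse; for square matrices it is
  two-sided.\<close>

lemma Sp_inverse:
  assumes "S \<in> Sp"
  shows "S ** matrix_inv S = mat 1" "matrix_inv S ** S = mat 1" "matrix_inv S \<in> Sp"
    and "matrix_inv S = - (sympl_J ** transpose S ** sympl_J)"
proof -
  have S: "transpose S ** sympl_J ** S = sympl_J"
    using assms by (simp add: Sp_def)
  have "- (sympl_J ** transpose S ** sympl_J) ** S = - (sympl_J ** (transpose S ** sympl_J ** S))"
    by (simp add: matrix_mul_assoc)
  also have "\<dots> = mat 1"
    by (simp add: S sympl_J_square)
  finally have right: "S ** - (sympl_J ** transpose S ** sympl_J) = mat 1"
    using matrix_left_right_inverse by blast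
  then show inv: "matrix_inv S = - (sympl_J ** transpose S ** sympl_J)"
    by (rule matrix_inv_unique)
  show 1: "S ** matrix_inv S = mat 1"
    unfolding inv by (rule right)
  then show "matrix_inv S ** S = mat 1"
    using matrix_left_right_inverse by blast
  have "transpose (matrix_inv S) ** sympl_J ** matrix_inv S
      = transpose (S ** matrix_inv S) ** sympl_J ** (S ** matrix_inv S)"
    by (subst S[symmetric]) (simp add: matrix_transpose_mul matrix_mul_assoc)
  then show "matrix_inv S \<in> Sp"
    by (simp add: 1 Sp_def)
qed

text \<open>Substituting the explicit inverse into \<open>S ** matrix_inv S ** sympl_J\<close> gives
  \<open>S ** sympl_J ** transpose S\<close>. It is used to show that
  \<open>transpose T ** T\<close> is symplectic.\<close>

lemma Sp_transpose:
  assumes "S \<in> Sp"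
  shows "transpose S \<in> Sp"
proof -
  have "sympl_J = S ** matrix_inv S ** sympl_J"
    by (simp add: Sp_inverse(1)[OF assms])
  also have "\<dots> = - (S ** sympl_J ** transpose S ** (sympl_J ** sympl_J))"
    by (simp add: Sp_inverse(4)[OF assms] matrix_mul_assoc)
  also have "\<dots> = S ** sympl_J ** transpose S"
    by (simp add: sympl_J_square)
  finally show ?thesis
    by (simp add: Sp_def)
qed

lemma matrix_eq_inner: "A = B" if "\<And>x y. (A *v x) \<bullet> y = (B *v x) \<bullet> y"
  for A B :: "real^'n^'m"
  using that vector_eq_rdot[of "A *v x" "B *v x" for x] unfolding matrix_eq by blast

text \<open>Polarization recovers the bilinear form of a symmetric matrix from its quadratic
  form.\<close>

lemma sym_matrix_eqI:
  fixes A B :: "real^'n^'n"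
  assumes "sym_matrix A" "sym_matrix B" "\<And>x. (A *v x) \<bullet> x = (B *v x) \<bullet> x"
  shows "A = B"
proof (rule matrix_eq_inner)
  fix x y
  have polar: "2 * ((M *v x) \<bullet> y) = (M *v (x + y)) \<bullet> (x + y) - (M *v x) \<bullet> x - (M *v y) \<bullet> y"
    if "sym_matrix M" for M :: "real^'n^'n"
    using sym_matrix_inner[OF that, of y x]
    by (simp add: matrix_vector_right_distrib inner_simps inner_commute)
  show "(A *v x) \<bullet> y = (B *v x) \<bullet> y"
    using polar[OF assms(1)] polar[OF assms(2)] unfolding assms(3) by simp
qed

lemma sym_pos_def_inner_eq_0: "sym_pos_def G \<Longrightarrow> (G *v x) \<bullet> x = 0 \<longleftrightarrow> x = 0"
  unfolding sym_pos_def_def by (cases "x = 0") force+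

lemma sym_pos_def_gram:
  fixes S :: "real^'n^'n"
  assumes "T ** S = mat 1"
  shows "sym_pos_def (transpose S ** S)"
  unfolding sym_pos_def_def sym_matrix_def
proof (intro conjI allI impI)
  fix x :: "real^'n" assume "x \<noteq> 0"
  then have "S *v x \<noteq> 0"
    by (metis assms matrix_vector_mul_assoc matrix_vector_mul_lid matrix_vector_mult_0_right)
  then show "(transpose S ** S *v x) \<bullet> x > 0"
    by (metis inner_gt_zero_iff inner_matrix_transpose matrix_vector_mul_assoc transpose_transpose)
qed (simp add: matrix_transpose_mul)

lemma gram_inner: "(transpose S ** S *v x) \<bullet> x = (S *v x) \<bullet> (S *v x)"
  for S :: "real^'n^'m"
  by (metis inner_matrix_transpose matrix_vector_mul_assoc transpose_transpose)

section \<open>Ellipsoids and the parameters they determine\<close>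

definition ellipsoid :: "real \<Rightarrow> real^'m^'m \<Rightarrow> real^'m \<Rightarrow> (real^'m) set" where
  "ellipsoid r G z0 = {z. (G *v (z - z0)) \<bullet> (z - z0) \<le> r}"

lemma mem_ellipsoid_add: "z0 + t *\<^sub>R w \<in> ellipsoid r G z0 \<longleftrightarrow> t\<^sup>2 * ((G *v w) \<bullet> w) \<le> r"
  by (simp add: ellipsoid_def matrix_vector_mult_scaleR power2_eq_square mult.assoc)

lemma mem_ellipsoid_reflect: "2 *\<^sub>R z0 - z \<in> ellipsoid r G z0 \<longleftrightarrow> z \<in> ellipsoid r G z0"
proof -
  have "2 *\<^sub>R z0 - z - z0 = - (z - z0)"
    by (simp add: scaleR_2)
  then show ?thesis
    by (simp only: ellipsoid_def mem_Collect_eq linear_neg[OF matrix_vector_mul_linear]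
        inner_minus_left inner_minus_right minus_minus)
qed

text \<open>If both points were centres, the ellipsoid would be invariant under the composition of the two point reflections,
  a translation, and so unbounded.\<close>

lemma ellipsoid_center_unique:
  assumes "r > 0" "sym_pos_def G" "ellipsoid r G z0 = ellipsoid r G' z0'"
  shows "z0 = z0'"
proof (rule ccontr)
  assume ne: "z0 \<noteq> z0'"
  define d where "d = 2 *\<^sub>R (z0' - z0)"
  have "d \<noteq> 0"
    using ne by (simp add: d_def)
  then have pos: "(G *v d) \<bullet> d > 0"
    using assms(2) by (simp add: sym_pos_def_def)
  have step: "z + d \<in> ellipsoid r G z0" if "z \<in> ellipsoid r G z0" for z
  proof -
    have "2 *\<^sub>R z0' - (2 *\<^sub>R z0 - z) \<in> ellipsoid r G z0"
      using that by (simp only: mem_ellipsoid_reflect assms(3)) (simp only: mem_ellipsoid_reflect flip: assms(3))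
    then show ?thesis
      by (simp add: d_def algebra_simps)
  qed
  have translates: "z0 + real k *\<^sub>R d \<in> ellipsoid r G z0" for k
  proof (induction k)
    case 0
    then show ?case using assms(1) by (simp add: ellipsoid_def)
  next
    case (Suc k)
    from step[OF this] show ?case by (simp add: algebra_simps)
  qed
  \<comment> \<open>The translates of the centre by multiples of \<open>d\<close> leave any bounded
    set: for natural \<open>k\<close> the form at \<open>k\<close> times \<open>d\<close> is at
    least \<open>k\<close> times the form at \<open>d\<close>, which here exceeds
    \<open>r\<close>.\<close>
  obtain k :: nat where k: "r / ((G *v d) \<bullet> d) < k"
    using reals_Archimedean2 by blast
  have "r < k * ((G *v d) \<bullet> d)"
    using k pos by (simp add: field_simps)
  also have "\<dots> \<le> (real k)\<^sup>2 * ((G *v d) \<bullet> d)"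
    using pos by (intro mult_right_mono) (auto simp: power2_eq_square simp flip: of_nat_mult)
  also have "\<dots> \<le> r"
    using translates by (simp add: mem_ellipsoid_add)
  finally show False by simp
qed

text \<open>Inclusion of concentric ellipsoids reverses the order of their forms. Applied in both
  directions it identifies the matrices.\<close>

lemma ellipsoid_inner_le:
  assumes "r > 0" "sym_pos_def G" "ellipsoid r G z0 \<subseteq> ellipsoid r G' z0"
  shows "(G' *v w) \<bullet> w \<le> (G *v w) \<bullet> w"
proof (cases "w = 0")
  case False
  then have pos: "(G *v w) \<bullet> w > 0"
    using assms(2) by (simp add: sym_pos_def_def)
  \<comment> \<open>This \<open>t\<close> scales \<open>w\<close> so that
    \<open>z0 + t *\<^sub>R w\<close> lies on the boundary of the smaller ellipsoid.\<close>
  define t where "t = sqrt (r / ((G *v w) \<bullet> w))"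
  have t: "t\<^sup>2 = r / ((G *v w) \<bullet> w)"
    using pos assms(1) by (simp add: t_def)
  then have "z0 + t *\<^sub>R w \<in> ellipsoid r G z0"
    using pos by (simp add: mem_ellipsoid_add)
  then have "r / ((G *v w) \<bullet> w) * ((G' *v w) \<bullet> w) \<le> r"
    using assms(3) mem_ellipsoid_add t by (metis subsetD)
  then show ?thesis
    using pos assms(1) by (simp add: field_simps)
qed simp

lemma ellipsoid_inject:
  assumes "r > 0" "sym_pos_def G" "sym_pos_def G'" "ellipsoid r G z0 = ellipsoid r G' z0'"
  shows "G = G'" "z0 = z0'"
proof -
  show "z0 = z0'"
    using assms ellipsoid_center_unique by blast
  then show "G = G'"
    using assms by (intro sym_matrix_eqI antisym ellipsoid_inner_le)
      (auto simp: sym_pos_def_def)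
qed

text \<open>The image of a ball under \<open>T\<close> is its preimage under the inverse
  \<open>S\<close>. An arbitrary inverse pair is allowed because \<open>T\<close> is later either
  the inverse of an \<open>S_matrix\<close> or a given symplectic matrix.\<close>

lemma quantum_blob_eq_ellipsoid:
  assumes "hbar > 0" and inv: "S ** T = mat 1"
  shows "quantum_blob hbar z0 T = ellipsoid hbar (transpose S ** S) z0"
proof -
  have "T ** S = mat 1"
    using inv matrix_left_right_inverse by blast
  then have TS: "T *v (S *v z) = z" "S *v (T *v z) = z" for z
    using inv by (simp_all add: matrix_vector_mul_assoc)
  have norm: "norm (S *v (z - z0)) \<le> sqrt hbar \<longleftrightarrow> z \<in> ellipsoid hbar (transpose S ** S) z0" for z
    by (simp add: ellipsoid_def gram_inner norm_eq_sqrt_inner)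
  have "z \<in> quantum_blob hbar z0 T \<longleftrightarrow> norm (S *v (z - z0)) \<le> sqrt hbar" for z
  proof
    assume "z \<in> quantum_blob hbar z0 T"
    then show "norm (S *v (z - z0)) \<le> sqrt hbar"
      by (auto simp: quantum_blob_def TS)
  next
    assume "norm (S *v (z - z0)) \<le> sqrt hbar"
    then show "z \<in> quantum_blob hbar z0 T"
      unfolding quantum_blob_def by (intro image_eqI[of _ _ "S *v (z - z0)"]) (auto simp: TS)
  qed
  then show ?thesis
    using norm by blast
qed

section \<open>The matrices \<open>S_matrix X Y\<close> and their Gram matrices\<close>

text \<open>Both parts are block computations with the symmetric root \<open>R\<close> of
  \<open>X\<close> and its inverse \<open>R'\<close>, where \<open>R' ** R'\<close> is
  \<open>matrix_inv X\<close>. In the Gram matrix the roots disappear, so \<open>X\<close> and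
  \<open>Y\<close> can be read off its blocks.\<close>

lemma S_matrix_Sp:
  assumes X: "sym_pos_def X" and Y: "sym_matrix Y"
  shows "S_matrix X Y \<in> Sp"
    and "transpose (S_matrix X Y) ** S_matrix X Y
      = block_matrix (X + Y ** matrix_inv X ** Y) (Y ** matrix_inv X) (matrix_inv X ** Y) (matrix_inv X)"
proof -
  define R where "R = matrix_sqrt X"
  define R' where "R' = matrix_inv R"
  have R: "sym_pos_def R" "R ** R = X"
    using matrix_sqrt[OF X] by (simp_all add: R_def)
  have R': "R ** R' = mat 1" "R' ** R = mat 1"
    using sym_pos_def_inverse[OF R(1)] by (simp_all add: R'_def)
  have sym: "transpose R = R" "transpose R' = R'" "transpose Y = Y"
    using R(1) sym_pos_def_inverse(1)[OF R(1)] Y by (simp_all add: R'_def sym_pos_def_def sym_matrix_def)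
  have "X ** (R' ** R') = R ** (R ** R') ** R'"
    by (simp add: R(2)[symmetric] matrix_mul_assoc)
  then have inv: "matrix_inv X = R' ** R'"
    by (intro matrix_inv_unique) (simp add: R')
  have S: "S_matrix X Y = block_matrix R 0 (R' ** Y) R'"
    by (simp add: S_matrix_def R_def R'_def)
  have "R ** (R' ** Y) = Y" "Y ** R' ** R = Y"
    using R' by (simp_all add: matrix_mul_assoc) (simp flip: matrix_mul_assoc)
  then show "S_matrix X Y \<in> Sp"
    by (simp add: S Sp_def sympl_J_def transpose_block_matrix block_matrix_mult sym R' matrix_transpose_mul)
  show "transpose (S_matrix X Y) ** S_matrix X Y
      = block_matrix (X + Y ** matrix_inv X ** Y) (Y ** matrix_inv X) (matrix_inv X ** Y) (matrix_inv X)"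
    by (simp add: S inv transpose_block_matrix block_matrix_mult sym R matrix_transpose_mul matrix_mul_assoc)
qed

lemma S_matrix_gram:
  assumes "sym_pos_def X" "sym_matrix Y"
  shows "sym_pos_def (transpose (S_matrix X Y) ** S_matrix X Y)"
  using sym_pos_def_gram Sp_inverse(2)[OF S_matrix_Sp(1)] assms by blast

lemma S_matrix_gram_inject:
  assumes X: "sym_pos_def X" and Y: "sym_matrix Y" and X': "sym_pos_def X'" and Y': "sym_matrix Y'"
    and eq: "transpose (S_matrix X Y) ** S_matrix X Y = transpose (S_matrix X' Y') ** S_matrix X' Y'"
  shows "X = X'" "Y = Y'"
proof -
  have inv: "matrix_inv X = matrix_inv X'" and mul: "matrix_inv X ** Y = matrix_inv X' ** Y'"
    using eq by (auto simp: S_matrix_Sp X Y X' Y')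
  show "X = X'"
    using inv sym_pos_def_inverse[OF X] sym_pos_def_inverse[OF X']
    by (metis matrix_mul_assoc matrix_mul_lid matrix_mul_rid)
  then show "Y = Y'"
    using mul sym_pos_def_inverse(2)[OF X] by (metis matrix_mul_assoc matrix_mul_lid)
qed

text \<open>\<open>G = transpose T ** T\<close> is symmetric, positive definite and symplectic. With
  blocks \<open>P\<close>, \<open>Q\<close>, \<open>Q'\<close>, \<open>N\<close>, the only possible
  choice is \<open>X = matrix_inv N\<close> and \<open>Y = X ** Q'\<close>. The symplectic relation
  \<open>N ** Q = Q' ** N\<close> makes \<open>Y\<close> symmetric, and
  \<open>P ** N - Q ** Q = mat 1\<close> forces the right upper left block.\<close>

lemma S_matrix_gram_surj:
  assumes "T \<in> Sp"
  obtains X Y where "sym_pos_def X" "sym_matrix Y"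
    "transpose (S_matrix X Y) ** S_matrix X Y = transpose T ** T"
proof -
  define G where "G = transpose T ** T"
  have symG: "transpose G = G"
    by (simp add: G_def matrix_transpose_mul)
  have G: "sym_pos_def G"
    unfolding G_def using Sp_inverse(2)[OF assms] by (rule sym_pos_def_gram)
  have "transpose (transpose T) ** sympl_J ** transpose T = sympl_J" "transpose T ** sympl_J ** T = sympl_J"
    using assms Sp_transpose[OF assms] by (simp_all add: Sp_def)
  \<comment> \<open>Regrouping, \<open>G ** sympl_J ** G\<close> has
    \<open>T ** sympl_J ** transpose T\<close> between \<open>transpose T\<close> and
    \<open>T\<close>, so both relations are used in turn.\<close>
  then have GJG: "G ** sympl_J ** G = sympl_J"
    unfolding G_def by (simp add: matrix_mul_assoc) (metis matrix_mul_assoc)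
  obtain P Q Q' N where blocks: "G = block_matrix P Q Q' N"
    by (rule block_matrix_cases)
  have trans: "transpose P = P" "transpose Q = Q'" "transpose N = N"
    using symG by (auto simp: blocks transpose_block_matrix)
  have "P ** N - Q ** Q = mat 1" "N ** Q = Q' ** N"
    using GJG by (auto simp: blocks sympl_J_def block_matrix_mult)
  have N: "sym_pos_def N"
    unfolding sym_pos_def_def sym_matrix_def
  proof (intro conjI allI impI)
    fix x :: "real^'a" assume "x \<noteq> 0"
    \<comment> \<open>On vectors with zero position part, the form of \<open>G\<close> is that of
      its block \<open>N\<close>.\<close>
    define z :: "'a phase" where "z = (\<chi> i. case i of Inl _ \<Rightarrow> 0 | Inr k \<Rightarrow> x $ k)"
    have z: "pos_part z = 0" "mom_part z = x"
      by (simp_all add: z_def pos_part_def mom_part_def vec_eq_iff)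
    then have "z \<noteq> 0"
      using \<open>x \<noteq> 0\<close> by (auto simp: mom_part_def zero_vec_def)
    then have "0 < (G *v z) \<bullet> z"
      using G by (simp add: sym_pos_def_def)
    then show "0 < (N *v x) \<bullet> x"
      by (simp add: blocks inner_phase pos_part_block_matrix mom_part_block_matrix z)
  qed (rule trans)
  define X where "X = matrix_inv N"
  define Y where "Y = X ** Q'"
  have X: "sym_pos_def X" "N ** X = mat 1" "X ** N = mat 1"
    using sym_pos_def_inverse[OF N] by (simp_all add: X_def)
  have invX: "matrix_inv X = N"
    using X(3) by (rule matrix_inv_unique)
  have QX: "Q ** X = Y"
  proof -
    have "Q ** X = X ** (N ** Q) ** X"
      by (simp add: matrix_mul_assoc X)
    also have "\<dots> = X ** Q' ** (N ** X)"
      by (simp add: \<open>N ** Q = Q' ** N\<close> matrix_mul_assoc)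
    finally show ?thesis
      by (simp add: X Y_def)
  qed
  have "transpose X = X"
    using X(1) by (simp add: sym_pos_def_def sym_matrix_def)
  then have Y: "sym_matrix Y"
    using QX trans(2) by (simp add: sym_matrix_def Y_def matrix_transpose_mul) (metis transpose_transpose)
  have NY: "N ** Y = Q'"
    by (simp add: Y_def matrix_mul_assoc X)
  have YN: "Y ** N = Q"
    unfolding QX[symmetric] by (simp flip: matrix_mul_assoc add: X)
  have "P = P ** N ** X"
    by (simp flip: matrix_mul_assoc add: X)
  also have "P ** N = mat 1 + Q ** Q"
    using \<open>P ** N - Q ** Q = mat 1\<close> by (simp add: algebra_simps)
  also have "(mat 1 + Q ** Q) ** X = X + Y ** N ** Y"
    by (simp only: matrix_add_rdistrib matrix_mul_lid YN QX flip: matrix_mul_assoc)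
  finally have "transpose (S_matrix X Y) ** S_matrix X Y = G"
    using S_matrix_Sp(2)[OF X(1) Y] by (simp add: blocks invX NY YN)
  with X(1) Y that show ?thesis
    by (simp add: G_def)
qed

section \<open>Squeezed states and quantum blobs\<close>

text \<open>Completing the square in the momentum. The two terms are the ones that the Wigner
  integral yields: the first from the modulus of the Gaussian, the second from its Fourier
  transform.\<close>

lemma S_matrix_gram_inner:
  assumes "sym_pos_def X" "sym_matrix Y"
  shows "(transpose (S_matrix X Y) ** S_matrix X Y *v z) \<bullet> z
    = (X *v pos_part z) \<bullet> pos_part z
      + (matrix_inv X *v (mom_part z + Y *v pos_part z)) \<bullet> (mom_part z + Y *v pos_part z)"
  unfolding S_matrix_Sp(2)[OF assms] inner_phase pos_part_block_matrix mom_part_block_matrix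
  by (simp add: matrix_vector_mul_assoc[symmetric] matrix_vector_mult_add_rdistrib matrix_vector_right_distrib
      inner_simps sym_matrix_inner[OF assms(2)])

text \<open>In the Wigner integrand the sum, applied to \<open>X\<close>, gives the modulus, and the
  difference, applied to \<open>Y\<close>, gives a phase linear in \<open>y\<close>.\<close>

lemma quadratic_form_shift:
  fixes A :: "real^'n^'n"
  assumes "sym_matrix A"
  shows "(A *v (x + (1/2) *\<^sub>R y)) \<bullet> (x + (1/2) *\<^sub>R y) + (A *v (x - (1/2) *\<^sub>R y)) \<bullet> (x - (1/2) *\<^sub>R y)
      = 2 * ((A *v x) \<bullet> x) + (A *v y) \<bullet> y / 2"
    and "(A *v (x + (1/2) *\<^sub>R y)) \<bullet> (x + (1/2) *\<^sub>R y) - (A *v (x - (1/2) *\<^sub>R y)) \<bullet> (x - (1/2) *\<^sub>R y)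
      = 2 * ((A *v x) \<bullet> y)"
  using sym_matrix_inner[OF assms, of y x]
  by (simp_all add: matrix_vector_right_distrib matrix_vector_mult_diff_distrib matrix_vector_mult_scaleR
      inner_simps inner_commute field_simps)

lemma scaleR_matrix_diag: "c *\<^sub>R A = diag_matrix (\<lambda>_. c) ** A"
  for A :: "real^'n^'n"
  by (simp add: diag_matrix_def matrix_matrix_mult_def vec_eq_iff if_distrib[of "\<lambda>a. a * _"] cong: if_cong)

lemma det_scaleR: "det (c *\<^sub>R A) = c ^ CARD('n) * det A"
  for A :: "real^'n^'n"
  by (simp add: scaleR_matrix_diag det_mul det_diag_matrix)

lemma sym_pos_def_scaleR:
  assumes "c > 0" "sym_pos_def A"
  shows "sym_pos_def (c *\<^sub>R A)" "matrix_inv (c *\<^sub>R A) = (1 / c) *\<^sub>R matrix_inv A"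
proof -
  show "sym_pos_def (c *\<^sub>R A)"
    using assms by (auto simp: sym_pos_def_def sym_matrix_def transpose_scalar simp flip: scaleR_matrix_vector_assoc)
  show "matrix_inv (c *\<^sub>R A) = (1 / c) *\<^sub>R matrix_inv A"
    using assms sym_pos_def_inverse(2)[OF assms(2)]
    by (intro matrix_inv_unique) (simp add: matrix_scalar_ac flip: scalar_matrix_assoc)
qed

text \<open>The factors are the prefactor of the Wigner transform, the squared normalization of
  \<open>Phi\<close>, and the constant of the Gaussian integral for \<open>X\<close> scaled by
  \<open>1 / (2 * hbar)\<close>; \<delta> stands for \<open>det X\<close> and cancels.\<close>

lemma wigner_normalization:
  fixes hbar \<delta> :: real
  assumes "hbar > 0" "\<delta> > 0"
  shows "(1 / (2 * pi * hbar)) ^ n * ((pi * hbar) powr (- real n / 4) * \<delta> powr (1/4))\<^sup>2 *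
      ((2 * pi) powr (real n / 2) * ((1 / (2 * hbar)) ^ n * \<delta>) powr (- 1 / 2)) = (pi * hbar) powr (- real n)"
proof -
  have pi_factor: "(1 / (2 * pi * hbar)) ^ n = 2 powr (- real n) * pi powr (- real n) * hbar powr (- real n)"
    using assms by (simp add: powr_minus powr_realpow power_mult_distrib field_simps)
  have norm_factor: "((pi * hbar) powr (- real n / 4) * \<delta> powr (1/4))\<^sup>2
      = pi powr (- real n / 2) * hbar powr (- real n / 2) * \<delta> powr (1/2)"
    using assms by (simp add: power_mult_distrib powr_mult power2_eq_square flip: powr_add)
      (simp add: powr_add[symmetric] mult_ac)
  have det_factor: "((1 / (2 * hbar)) ^ n * \<delta>) powr (- 1 / 2)
      = 2 powr (real n / 2) * hbar powr (real n / 2) * \<delta> powr (- 1 / 2)"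
  proof -
    have "(1 / (2 * hbar)) ^ n = (2 * hbar) powr (- real n)"
      using assms by (simp add: powr_minus powr_realpow field_simps)
    then show ?thesis
      using assms by (simp add: powr_mult powr_powr)
  qed
  have "(1 / (2 * pi * hbar)) ^ n * ((pi * hbar) powr (- real n / 4) * \<delta> powr (1/4))\<^sup>2 *
      ((2 * pi) powr (real n / 2) * ((1 / (2 * hbar)) ^ n * \<delta>) powr (- 1 / 2))
      = (2 powr (- real n) * 2 powr (real n / 2) * 2 powr (real n / 2))
        * (pi powr (- real n) * pi powr (- real n / 2) * pi powr (real n / 2))
        * (hbar powr (- real n) * hbar powr (- real n / 2) * hbar powr (real n / 2))
        * (\<delta> powr (1/2) * \<delta> powr (- 1 / 2))"
    unfolding pi_factor norm_factor det_factor by (simp add: powr_mult mult_ac)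
  also have "\<dots> = pi powr (- real n) * hbar powr (- real n)"
    using assms by (simp flip: powr_add)
  finally show ?thesis
    using assms by (simp add: powr_mult)
qed

text \<open>For fixed \<open>z\<close> the integrand is a constant times a Gaussian in
  \<open>y\<close> with matrix \<open>A\<close> and frequency \<open>k\<close>, so
  \<open>gaussian_fourier\<close> evaluates the integral.\<close>

theorem wigner_squeezed_state:
  fixes X Y :: "real^'n^'n"
  assumes h: "hbar > 0" and X: "sym_pos_def X" and Y: "sym_matrix Y"
  shows "has_gaussian_wigner hbar (Phi_at hbar X Y z0) (transpose (S_matrix X Y) ** S_matrix X Y) z0"
  unfolding has_gaussian_wigner_def
proof
  fix z :: "'n phase"
  define x where "x = pos_part (z - z0)"
  define v where "v = mom_part (z - z0) + Y *v x"
  define k where "k = (1 / hbar) *\<^sub>R v"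
  define A where "A = (1 / (2 * hbar)) *\<^sub>R X"
  define c where "c = (pi * hbar) powr (- real CARD('n) / 4) * det X powr (1/4)"
  define q where "q = (X *v x) \<bullet> x"
  have A: "sym_pos_def A" "matrix_inv A = (2 * hbar) *\<^sub>R matrix_inv X"
    using sym_pos_def_scaleR[of "1 / (2 * hbar)" X] h X by (simp_all add: A_def)
  have symX: "sym_matrix X"
    using X by (simp add: sym_pos_def_def)
  have integrand: "exp (- (\<i> / of_real hbar) * of_real (mom_part z \<bullet> y)) *
        Phi_at hbar X Y z0 (pos_part z + (1/2) *\<^sub>R y) * cnj (Phi_at hbar X Y z0 (pos_part z - (1/2) *\<^sub>R y))
      = of_real (c\<^sup>2 * exp (- q / hbar)) * exp (- (of_real ((A *v y) \<bullet> y / 2) + \<i> * of_real (k \<bullet> y)))" for y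
  proof -
    define u where "u = x + (1/2) *\<^sub>R y"
    define w where "w = x - (1/2) *\<^sub>R y"
    have pos: "pos_part z + (1/2) *\<^sub>R y - pos_part z0 = u" "pos_part z - (1/2) *\<^sub>R y - pos_part z0 = w"
      by (simp_all add: u_def w_def x_def pos_part_diff)
    \<comment> \<open>\<open>a\<close> and \<open>b\<close> are the phases, times
      \<open>hbar\<close>, that the displacement contributes at the two arguments. Conjugation
      leaves only their difference, in which the constant term cancels.\<close>
    define a where "a = mom_part z0 \<bullet> (pos_part z + (1/2) *\<^sub>R y) - 1/2 * (mom_part z0 \<bullet> pos_part z0)"
    define b where "b = mom_part z0 \<bullet> (pos_part z - (1/2) *\<^sub>R y) - 1/2 * (mom_part z0 \<bullet> pos_part z0)"
    define e where "e = - (\<i> / of_real hbar) * of_real (mom_part z \<bullet> y)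
      + (\<i> / of_real hbar * of_real a - of_real (1 / (2 * hbar)) * (of_real ((X *v u) \<bullet> u) + \<i> * of_real ((Y *v u) \<bullet> u)))
      + (- \<i> / of_real hbar * of_real b - of_real (1 / (2 * hbar)) * (of_real ((X *v w) \<bullet> w) - \<i> * of_real ((Y *v w) \<bullet> w)))"
    have "Phi_at hbar X Y z0 (pos_part z + (1/2) *\<^sub>R y)
        = of_real c * exp (\<i> / of_real hbar * of_real a
            - of_real (1 / (2 * hbar)) * (of_real ((X *v u) \<bullet> u) + \<i> * of_real ((Y *v u) \<bullet> u)))"
      unfolding Phi_at_def heisenberg_weyl_def Phi_def pos c_def[symmetric] a_def[symmetric]
      by (simp only: diff_conv_add_uminus exp_add mult_minus_left mult_ac)
    moreover have "cnj (Phi_at hbar X Y z0 (pos_part z - (1/2) *\<^sub>R y))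
        = of_real c * exp (- \<i> / of_real hbar * of_real b
            - of_real (1 / (2 * hbar)) * (of_real ((X *v w) \<bullet> w) - \<i> * of_real ((Y *v w) \<bullet> w)))"
      unfolding Phi_at_def heisenberg_weyl_def Phi_def pos c_def[symmetric] b_def[symmetric]
      by (simp add: exp_cnj mult_exp_exp algebra_simps)
    ultimately have "exp (- (\<i> / of_real hbar) * of_real (mom_part z \<bullet> y)) *
        Phi_at hbar X Y z0 (pos_part z + (1/2) *\<^sub>R y) * cnj (Phi_at hbar X Y z0 (pos_part z - (1/2) *\<^sub>R y))
      = of_real (c\<^sup>2) * exp e"
      unfolding e_def exp_add by (simp add: power2_eq_square)
    also have "e = of_real (- q / hbar) + - (of_real ((A *v y) \<bullet> y / 2) + \<i> * of_real (k \<bullet> y))"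
    proof -
      have "Re e = - 1 / (2 * hbar) * ((X *v u) \<bullet> u + (X *v w) \<bullet> w)"
        by (simp add: e_def algebra_simps add_divide_distrib)
      also have "\<dots> = - q / hbar - (A *v y) \<bullet> y / 2"
        unfolding u_def w_def quadratic_form_shift(1)[OF symX] q_def A_def using h
        by (simp add: field_simps flip: scaleR_matrix_vector_assoc)
      finally have re: "Re e = - q / hbar - (A *v y) \<bullet> y / 2" .
      have "Im e = - (mom_part z \<bullet> y) / hbar + (a - b) / hbar - 1 / (2 * hbar) * ((Y *v u) \<bullet> u - (Y *v w) \<bullet> w)"
        using h by (simp add: e_def field_simps)
      also have "a - b = mom_part z0 \<bullet> y"
        by (simp add: a_def b_def inner_simps)
      also have "(Y *v u) \<bullet> u - (Y *v w) \<bullet> w = 2 * ((Y *v x) \<bullet> y)"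
        unfolding u_def w_def by (rule quadratic_form_shift(2)[OF Y])
      finally have "Im e = - (k \<bullet> y)"
        using h by (simp add: k_def v_def mom_part_diff inner_simps field_simps)
      with re show ?thesis
        by (simp add: complex_eq_iff)
    qed
    finally show ?thesis
      by (simp only: exp_add exp_of_real of_real_mult mult.assoc)
  qed
  \<comment> \<open>The inverse of \<open>A\<close> contributes \<open>2 * hbar\<close>, and the two
    copies of \<open>k\<close> contribute \<open>1 / hbar\<close> each.\<close>
  have Ak: "(matrix_inv A *v k) \<bullet> k / 2 = (matrix_inv X *v v) \<bullet> v / hbar"
    using h by (simp add: A(2) k_def matrix_vector_mult_scaleR flip: scaleR_matrix_vector_assoc)
  have detX: "det X > 0"
    using X by (rule gaussian_fourier(1))
  have detA: "det A = (1 / (2 * hbar)) ^ CARD('n) * det X"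
    unfolding A_def by (rule det_scaleR)
  have "wigner hbar (Phi_at hbar X Y z0) z = of_real ((1 / (2 * pi * hbar)) ^ CARD('n)) *
      (of_real (c\<^sup>2 * exp (- q / hbar)) * of_real ((2 * pi) powr (real CARD('n) / 2) * det A powr (- 1 / 2) *
        exp (- ((matrix_inv A *v k) \<bullet> k) / 2)))"
    unfolding wigner_def integrand by (simp only: integral_mult_right_zero gaussian_fourier(2)[OF A(1)])
  also have "\<dots> = of_real (((1 / (2 * pi * hbar)) ^ CARD('n) * c\<^sup>2 *
      ((2 * pi) powr (real CARD('n) / 2) * ((1 / (2 * hbar)) ^ CARD('n) * det X) powr (- 1 / 2))) *
      (exp (- q / hbar) * exp (- ((matrix_inv A *v k) \<bullet> k) / 2)))"
    unfolding detA by (simp only: of_real_mult mult_ac)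
  also have "\<dots> = of_real ((pi * hbar) powr (- real CARD('n)) * exp (- (1 / hbar) * (q + (matrix_inv X *v v) \<bullet> v)))"
    unfolding c_def wigner_normalization[OF h detX]
    unfolding exp_add[symmetric] minus_divide_left[symmetric] Ak
    by (simp add: add_divide_distrib)
  also have "q + (matrix_inv X *v v) \<bullet> v = (transpose (S_matrix X Y) ** S_matrix X Y *v (z - z0)) \<bullet> (z - z0)"
    unfolding S_matrix_gram_inner[OF X Y] by (simp add: q_def v_def x_def)
  finally show "wigner hbar (Phi_at hbar X Y z0) z = of_real ((pi * hbar) powr (- real CARD('n)) *
      exp (- (1 / hbar) * ((transpose (S_matrix X Y) ** S_matrix X Y *v (z - z0)) \<bullet> (z - z0))))" .
qed

text \<open>Comparing exponents equates the two quadratic functions. At \<open>z0'\<close> the right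
  one vanishes, so definiteness of \<open>G\<close> gives equal centres, and polarization gives
  equal matrices.\<close>

lemma has_gaussian_wigner_unique:
  assumes h: "hbar > 0" and G: "sym_pos_def G" "has_gaussian_wigner hbar \<Psi> G z0"
    and G': "sym_pos_def G'" "has_gaussian_wigner hbar \<Psi> G' z0'"
  shows "G = G'" "z0 = z0'"
proof -
  have eq: "(G *v (z - z0)) \<bullet> (z - z0) = (G' *v (z - z0')) \<bullet> (z - z0')" for z
  proof -
    have "of_real ((pi * hbar) powr (- real CARD('a)) * exp (- (1 / hbar) * ((G *v (z - z0)) \<bullet> (z - z0))))
      = (of_real ((pi * hbar) powr (- real CARD('a)) * exp (- (1 / hbar) * ((G' *v (z - z0')) \<bullet> (z - z0')))) :: complex)"
      using G(2) G'(2) unfolding has_gaussian_wigner_def by metis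
    then show ?thesis
      using h unfolding of_real_eq_iff by simp
  qed
  show "z0 = z0'"
    using eq[of z0'] sym_pos_def_inner_eq_0[OF G(1)] by simp
  then have "(G *v w) \<bullet> w = (G' *v w) \<bullet> w" for w
    using eq[of "z0 + w"] by simp
  then show "G = G'"
    using G(1) G'(1) by (intro sym_matrix_eqI) (auto simp: sym_pos_def_def)
qed

section \<open>Phase classes and parametrization of both sides\<close>

lemma equiv_phase_rel: "equiv UNIV (phase_rel hbar :: ((real^'n::finite \<Rightarrow> complex) \<times> _) set)"
  (is "equiv UNIV ?R")
proof (rule equivI)
  show "refl ?R"
    by (auto simp: phase_rel_def refl_on_def intro: exI[of _ 0])
  show "sym ?R"
  proof (rule symI)
    fix \<Psi> \<Psi>' :: "real^'n \<Rightarrow> complex" assume "(\<Psi>, \<Psi>') \<in> ?R"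
    then obtain \<gamma> where \<gamma>: "\<Psi>' = (\<lambda>x. exp (\<i> / of_real hbar * of_real \<gamma>) * \<Psi> x)"
      by (auto simp: phase_rel_def)
    have "\<Psi> = (\<lambda>x. exp (\<i> / of_real hbar * of_real (- \<gamma>)) * \<Psi>' x)"
      by (simp add: \<gamma> fun_eq_iff mult_exp_exp flip: mult.assoc)
    then show "(\<Psi>', \<Psi>) \<in> ?R"
      unfolding phase_rel_def by blast
  qed
  show "trans ?R"
  proof (rule transI)
    fix \<Psi> \<Psi>' \<Psi>'' :: "real^'n \<Rightarrow> complex" assume "(\<Psi>, \<Psi>') \<in> ?R" "(\<Psi>', \<Psi>'') \<in> ?R"
    then obtain \<gamma> \<gamma>' where "\<Psi>' = (\<lambda>x. exp (\<i> / of_real hbar * of_real \<gamma>) * \<Psi> x)"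
      "\<Psi>'' = (\<lambda>x. exp (\<i> / of_real hbar * of_real \<gamma>') * \<Psi>' x)"
      by (auto simp: phase_rel_def)
    then have "\<Psi>'' = (\<lambda>x. exp (\<i> / of_real hbar * of_real (\<gamma> + \<gamma>')) * \<Psi> x)"
      by (simp add: exp_add distrib_left mult_ac)
    then show "(\<Psi>, \<Psi>'') \<in> ?R"
      unfolding phase_rel_def by blast
  qed
qed auto

text \<open>The integrand contains the phase factor once as it is and once conjugated, and its
  modulus is one.\<close>

lemma wigner_phase_rel:
  assumes "(\<Psi>, \<Psi>') \<in> phase_rel hbar"
  shows "wigner hbar \<Psi>' = wigner hbar \<Psi>"
proof -
  obtain \<gamma> where \<Psi>': "\<Psi>' = (\<lambda>x. exp (\<i> / of_real hbar * of_real \<gamma>) * \<Psi> x)"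
    using assms by (auto simp: phase_rel_def)
  have "exp (\<i> / of_real hbar * of_real \<gamma>) * cnj (exp (\<i> / of_real hbar * of_real \<gamma>)) = 1"
    by (simp add: exp_cnj mult_exp_exp)
  then have cancel: "e * (exp (\<i> / of_real hbar * of_real \<gamma>) * s) * cnj (exp (\<i> / of_real hbar * of_real \<gamma>) * t)
      = e * s * cnj t" for e s t
    by (metis (no_types, opaque_lifting) complex_cnj_mult mult.assoc mult.left_commute mult_1)
  show ?thesis
    unfolding wigner_def \<Psi>' by (intro ext) (simp only: cancel)
qed

lemma phase_class_eq_iff: "phase_class hbar \<Psi> = phase_class hbar \<Psi>' \<longleftrightarrow> (\<Psi>, \<Psi>') \<in> phase_rel hbar"
  unfolding phase_class_def by (rule eq_equiv_class_iff[OF equiv_phase_rel]) auto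

text \<open>The phase is absorbed into the class, which leaves only the parameters \<open>X\<close>,
  \<open>Y\<close>, \<open>z0\<close>.\<close>

lemma CS_eq: "CS hbar = {phase_class hbar (Phi_at hbar X Y z0) | X Y z0. sym_pos_def X \<and> sym_matrix Y}"
proof -
  have phase: "phase_rel hbar `` {\<lambda>x. exp (\<i> / of_real hbar * of_real \<gamma>) * \<Psi> x} = phase_class hbar \<Psi>"
    for \<gamma> and \<Psi> :: "real^'a \<Rightarrow> complex"
    using phase_class_eq_iff[of hbar \<Psi> "\<lambda>x. exp (\<i> / of_real hbar * of_real \<gamma>) * \<Psi> x"]
    by (auto simp: phase_class_def phase_rel_def)
  show ?thesis
  proof (intro subset_antisym subsetI)
    fix C :: "(real^'a \<Rightarrow> complex) set" assume "C \<in> CS hbar"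
    then obtain \<Psi> where \<Psi>: "\<Psi> \<in> squeezed_states hbar" and C: "C = phase_rel hbar `` {\<Psi>}"
      unfolding CS_def by (rule quotientE)
    from \<Psi> obtain \<gamma> X Y z0 where XY: "sym_pos_def X" "sym_matrix Y"
      and "\<Psi> = (\<lambda>x. exp (\<i> / of_real hbar * of_real \<gamma>) * Phi_at hbar X Y z0 x)"
      unfolding squeezed_states_def by auto
    then have "C = phase_class hbar (Phi_at hbar X Y z0)"
      by (simp only: C phase)
    with XY show "C \<in> {phase_class hbar (Phi_at hbar X Y z0) | X Y z0. sym_pos_def X \<and> sym_matrix Y}"
      by auto
  next
    fix C :: "(real^'a \<Rightarrow> complex) set"
    assume "C \<in> {phase_class hbar (Phi_at hbar X Y z0) | X Y z0. sym_pos_def X \<and> sym_matrix Y}"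
    then obtain X Y z0 where XY: "sym_pos_def X" "sym_matrix Y" and C: "C = phase_class hbar (Phi_at hbar X Y z0)"
      by auto
    have "(\<lambda>x. exp (\<i> / of_real hbar * of_real 0) * Phi_at hbar X Y z0 x) \<in> squeezed_states hbar"
      unfolding squeezed_states_def mem_Collect_eq using XY
      by (intro exI[of _ 0] exI[of _ X] exI[of _ Y] exI[of _ z0] conjI refl)
    then show "C \<in> CS hbar"
      unfolding CS_def C phase[of 0, symmetric] by (rule quotientI)
  qed
qed

lemma quantum_blob_S_matrix:
  assumes "hbar > 0" "sym_pos_def X" "sym_matrix Y"
  shows "quantum_blob hbar z0 (matrix_inv (S_matrix X Y)) = ellipsoid hbar (transpose (S_matrix X Y) ** S_matrix X Y) z0"
  using assms by (intro quantum_blob_eq_ellipsoid Sp_inverse S_matrix_Sp)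

text \<open>By \<open>quantum_blob_eq_ellipsoid\<close> a blob depends on its symplectic matrix only
  through the Gram matrix of the inverse, and \<open>S_matrix_gram_surj\<close> realizes that Gram
  matrix by some \<open>S_matrix X Y\<close>.\<close>

lemma QB_eq:
  assumes "hbar > 0"
  shows "QB hbar = {quantum_blob hbar z0 (matrix_inv (S_matrix X Y)) | X Y z0. sym_pos_def X \<and> sym_matrix Y}"
    (is "_ = ?B")
proof
  show "QB hbar \<subseteq> ?B"
  proof
    fix B :: "'a phase set" assume "B \<in> QB hbar"
    then obtain z0 S where S: "S \<in> Sp" and B: "B = quantum_blob hbar z0 S"
      by (auto simp: QB_def)
    obtain X Y where XY: "sym_pos_def X" "sym_matrix Y"
      "transpose (S_matrix X Y) ** S_matrix X Y = transpose (matrix_inv S) ** matrix_inv S"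
      using S_matrix_gram_surj Sp_inverse(3)[OF S] by blast
    have "B = ellipsoid hbar (transpose (matrix_inv S) ** matrix_inv S) z0"
      unfolding B by (rule quantum_blob_eq_ellipsoid[OF assms Sp_inverse(2)[OF S]])
    also have "\<dots> = quantum_blob hbar z0 (matrix_inv (S_matrix X Y))"
      using XY assms by (simp add: quantum_blob_S_matrix)
    finally show "B \<in> ?B"
      using XY by blast
  qed
  show "?B \<subseteq> QB hbar"
    unfolding QB_def using S_matrix_Sp(1) Sp_inverse(3) by blast
qed

section \<open>The bijection between states and blobs\<close>

theorem proposition6:
  fixes hbar :: real
  assumes "hbar > 0"
  shows "\<exists>\<G> :: (real^'n::finite \<Rightarrow> complex) set \<Rightarrow> 'n phase set.
    bij_betw \<G> (CS hbar) (QB hbar) \<and>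
    (\<forall>X Y z0. sym_pos_def X \<and> sym_matrix Y \<longrightarrow>
       S_matrix X Y \<in> Sp \<and>
       (\<exists>!G. sym_pos_def G \<and> has_gaussian_wigner hbar (Phi_at hbar X Y z0) G z0) \<and>
       (\<forall>G. sym_pos_def G \<and> has_gaussian_wigner hbar (Phi_at hbar X Y z0) G z0 \<longrightarrow>
          \<G> (phase_class hbar (Phi_at hbar X Y z0))
            = {z. (G *v (z - z0)) \<bullet> (z - z0) \<le> hbar} \<and>
          {z. (G *v (z - z0)) \<bullet> (z - z0) \<le> hbar}
            = quantum_blob hbar z0 (matrix_inv (S_matrix X Y))))"
proof -
  define P :: "((real^'n^'n) \<times> (real^'n^'n) \<times> 'n phase) set"
    where "P = {(X, Y, z0). sym_pos_def X \<and> sym_matrix Y}"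
  define state where "state = (\<lambda>(X, Y, z0 :: 'n phase). phase_class hbar (Phi_at hbar X Y z0))"
  define blob where "blob = (\<lambda>(X, Y, z0 :: 'n phase). quantum_blob hbar z0 (matrix_inv (S_matrix X Y)))"
  note wigner = wigner_squeezed_state[OF assms]
  have "inj_on state P"
  proof (rule inj_onI, clarsimp simp: P_def state_def)
    fix X Y X' Y' :: "real^'n^'n" and z0 z0' :: "'n phase"
    assume XY: "sym_pos_def X" "sym_matrix Y" and XY': "sym_pos_def X'" "sym_matrix Y'"
      and eq: "phase_class hbar (Phi_at hbar X Y z0) = phase_class hbar (Phi_at hbar X' Y' z0')"
    have "wigner hbar (Phi_at hbar X' Y' z0') = wigner hbar (Phi_at hbar X Y z0)"
      using eq by (intro wigner_phase_rel) (simp only: phase_class_eq_iff)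
    \<comment> \<open>One function now has two Gaussian Wigner forms, to which uniqueness
      applies.\<close>
    then have wigner': "has_gaussian_wigner hbar (Phi_at hbar X Y z0) (transpose (S_matrix X' Y') ** S_matrix X' Y') z0'"
      using wigner[OF XY', of z0'] by (simp add: has_gaussian_wigner_def)
    note unique = has_gaussian_wigner_unique[OF assms S_matrix_gram[OF XY] wigner[OF XY] S_matrix_gram[OF XY'] wigner']
    then show "X = X' \<and> Y = Y' \<and> z0 = z0'"
      using S_matrix_gram_inject[OF XY XY'] by blast
  qed
  moreover have "state ` P = CS hbar"
    by (force simp: CS_eq state_def P_def)
  ultimately have state: "bij_betw state P (CS hbar)"
    by (simp add: bij_betw_def)
  have "inj_on blob P"
  proof (rule inj_onI, clarsimp simp: P_def blob_def quantum_blob_S_matrix[OF assms])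
    fix X Y X' Y' :: "real^'n^'n" and z0 z0' :: "'n phase"
    assume XY: "sym_pos_def X" "sym_matrix Y" and XY': "sym_pos_def X'" "sym_matrix Y'"
      and eq: "ellipsoid hbar (transpose (S_matrix X Y) ** S_matrix X Y) z0
        = ellipsoid hbar (transpose (S_matrix X' Y') ** S_matrix X' Y') z0'"
    show "X = X' \<and> Y = Y' \<and> z0 = z0'"
      using ellipsoid_inject[OF assms S_matrix_gram[OF XY] S_matrix_gram[OF XY'] eq] S_matrix_gram_inject[OF XY XY'] by blast
  qed
  moreover have "blob ` P = QB hbar"
    by (force simp: QB_eq[OF assms] blob_def P_def)
  ultimately have blob: "bij_betw blob P (QB hbar)"
    by (simp add: bij_betw_def)
  \<comment> \<open>Since \<open>state\<close> is a bijection, each class has exactly one parameter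
    triple, and \<G> sends the class to the blob of that triple.\<close>
  define \<G> where "\<G> = blob \<circ> inv_into P state"
  have "bij_betw \<G> (CS hbar) (QB hbar)"
    unfolding \<G>_def using state blob by (intro bij_betw_trans[OF bij_betw_inv_into])
  moreover have "S_matrix X Y \<in> Sp \<and>
       (\<exists>!G. sym_pos_def G \<and> has_gaussian_wigner hbar (Phi_at hbar X Y z0) G z0) \<and>
       (\<forall>G. sym_pos_def G \<and> has_gaussian_wigner hbar (Phi_at hbar X Y z0) G z0 \<longrightarrow>
          \<G> (phase_class hbar (Phi_at hbar X Y z0)) = {z. (G *v (z - z0)) \<bullet> (z - z0) \<le> hbar} \<and>
          {z. (G *v (z - z0)) \<bullet> (z - z0) \<le> hbar} = quantum_blob hbar z0 (matrix_inv (S_matrix X Y)))"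
    if XY: "sym_pos_def X" "sym_matrix Y" for X Y :: "real^'n^'n" and z0
  proof -
    let ?G = "transpose (S_matrix X Y) ** S_matrix X Y"
    have G: "sym_pos_def ?G" "has_gaussian_wigner hbar (Phi_at hbar X Y z0) ?G z0"
      using S_matrix_gram[OF XY] wigner[OF XY] by auto
    \<comment> \<open>Every admissible \<open>G\<close> is the Gram matrix, so the clauses about all
      \<open>G\<close> concern a single matrix.\<close>
    have unique: "G = ?G" if "sym_pos_def G" "has_gaussian_wigner hbar (Phi_at hbar X Y z0) G z0" for G
      using has_gaussian_wigner_unique(1)[OF assms that G] .
    with G have ex1: "\<exists>!G. sym_pos_def G \<and> has_gaussian_wigner hbar (Phi_at hbar X Y z0) G z0"
      by blast
    have "\<G> (phase_class hbar (Phi_at hbar X Y z0)) = blob (X, Y, z0)"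
      using bij_betw_inv_into_left[OF state, of "(X, Y, z0)"] XY by (simp add: \<G>_def P_def state_def)
    then have "\<G> (phase_class hbar (Phi_at hbar X Y z0)) = quantum_blob hbar z0 (matrix_inv (S_matrix X Y))"
      by (simp add: blob_def)
    moreover have "quantum_blob hbar z0 (matrix_inv (S_matrix X Y)) = {z. (?G *v (z - z0)) \<bullet> (z - z0) \<le> hbar}"
      using quantum_blob_S_matrix[OF assms XY] by (simp only: ellipsoid_def)
    ultimately show ?thesis
      using S_matrix_Sp(1)[OF XY] ex1 by (auto dest!: unique)
  qed
  ultimately show ?thesis
    by blast
qed

end
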